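(* Let $\Omega\subset\mathbb{C}^n$ be a smooth bounded strongly pseudoconvex domain and let $\varphi=(\varphi_1,\ldots,\varphi_n):\Omega\to\Omega$ with $\varphi\in C^2(\overline\Omega)$. Let $K=\varphi(\partial\Omega)\cap\partial\Omega$ and let $F=\varphi^{-1}(K)\subset\partial\Omega$. Assume there is an open neighborhood $U$ of $F$ such that $\varphi$ is one-to-one on $U\cap\Omega$. Also assume that for every $i=1,\ldots,n$, $\overline\partial\varphi_i=0$ on $F$, and that the real Jacobian $J_\varphi$ satisfies $|J_\varphi(z)|\ge m$ for all $z\in F$, for some $m>0$. Then the operator $K_\varphi$ is bounded on $A^2(\Omega)$ if and only if \[\sup_{z\in\Omega}\int_\Omega |k_z(\varphi(w))|^2\,dV(w)<\infty.\]
   Context: $L^2(\Omega)$ is the space of square-integrable functions on $\Omega$ with respect to Lebesgue measure $dV$, with norm $\|\cdot\|_2$. $H(\Omega)$ is the space of holomorphic functions on $\Omega$, and $A^2(\Omega)=H(\Omega)\cap L^2(\Omega)$ is the Bergman space. $P:L^2(\Omega)\to A^2(\Omega)$ is the orthogonal projection (Bergman projection). For $f\in A^2(\Omega)$ with $f\circ\varphi\in L^2(\Omega)$, $K_\varphi f=P(f\circ\varphi)$. "$K_\varphi$ is bounded on $A^2(\Omega)$" means that $f\circ\varphi\in L^2(\Omega)$ for every $f\in A^2(\Omega)$ and there is $C>0$ with $\|K_\varphi f\|_2\le C\|f\|_2$ for all $f\in A^2(\Omega)$. Let $B(z,w)$ denote the Bergman kernel of $\Omega$ (the reproducing kernel of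 $A^2(\Omega)$); $k_z(w)=B(z,z)^{-1/2}B(z,w)$ is the normalized Bergman kernel. "Smooth bounded" means that $\Omega$ is bounded and there is a $C^\infty$ real-valued function $r$ on a neighborhood of $\overline\Omega$ with $\Omega=\{r<0\}$ and $dr\ne0$ when $r=0$. $\Omega$ is strongly pseudoconvex if $i\partial\overline\partial r(p)(\xi,\overline\xi)>0$ for all $p\in\partial\Omega$ and all nonzero $\xi\in\mathbb{C}^n$ with $\partial r(p)(\xi)=0$. $\varphi\in C^2(\overline\Omega)$ means that $\varphi$ and its partial derivatives of order at most $2$ extend continuously to $\overline\Omega$; the extension $\overline\Omega\to\overline\Omega$ is still denoted $\varphi$, and $\varphi(\partial\Omega)$ and $\varphi^{-1}(K)$ refer to this extension. $\overline\partial\varphi_i=0$ at a point means $\partial\varphi_i/\partial\overline z_j=0$ there for all $j=1,\ldots,n$. $J_\varphi$ is the determinant of the real $2n\times 2n$ Jacobian matrix of $\varphi$. $U$ is open in $\mathbb{C}^n$ and contains $F$. *)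

theory Defs
  imports "HOL-Analysis.Analysis"
begin

section \<open>Partial derivatives and smoothness classes\<close>

definition partial_deriv ::
    "'a::real_normed_vector \<Rightarrow> ('a \<Rightarrow> 'b::real_normed_vector) \<Rightarrow> 'a \<Rightarrow> 'b" where
  "partial_deriv v f x = frechet_derivative f (at x) v"

primrec iter_partial ::
    "'a::real_normed_vector list \<Rightarrow> ('a \<Rightarrow> 'b::real_normed_vector) \<Rightarrow> 'a \<Rightarrow> 'b" where
  "iter_partial [] f = f"
| "iter_partial (v # vs) f = partial_deriv v (iter_partial vs f)"

text \<open>The following are meant for open \<open>S\<close>.  The standard basis of \<open>complex ^ 'n\<close> consists of
  the real coordinate directions \<open>axis j 1\<close> and \<open>axis j \<i>\<close>.\<close>

definition Ck_on ::
    "nat \<Rightarrow> 'a::euclidean_space set \<Rightarrow> ('a \<Rightarrow> 'b::real_normed_vector) \<Rightarrow> bool" where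
  "Ck_on k S f \<longleftrightarrow> (\<forall>vs. set vs \<subseteq> Basis \<longrightarrow>
     (length vs < k \<longrightarrow> iter_partial vs f differentiable_on S) \<and>
     (length vs \<le> k \<longrightarrow> continuous_on S (iter_partial vs f)))"

definition smooth_on ::
    "'a::euclidean_space set \<Rightarrow> ('a \<Rightarrow> 'b::real_normed_vector) \<Rightarrow> bool" where
  "smooth_on S f \<longleftrightarrow> (\<forall>k. Ck_on k S f)"

definition Ck_closure ::
    "nat \<Rightarrow> 'a::euclidean_space set \<Rightarrow> ('a \<Rightarrow> 'b::real_normed_vector) \<Rightarrow> bool" where
  "Ck_closure k S f \<longleftrightarrow> Ck_on k S f \<and>
     (\<forall>vs. set vs \<subseteq> Basis \<and> length vs \<le> k \<longrightarrow>
       (\<exists>g. continuous_on (closure S) g \<and> (\<forall>x\<in>S. g x = iter_partial vs f x)))"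

text \<open>If \<open>g\<close> on \<open>S\<close> has a continuous extension to \<open>closure S\<close>, then \<open>cont_ext S g\<close> is that
  extension.  The values of \<open>g\<close> outside \<open>S\<close> are irrelevant.\<close>

definition cont_ext ::
    "'a::topological_space set \<Rightarrow> ('a \<Rightarrow> 'b::t2_space) \<Rightarrow> 'a \<Rightarrow> 'b" where
  "cont_ext S g p = (if p \<in> S then g p else Lim (at p within S) g)"

section \<open>Complex derivatives and the real Jacobian\<close>

definition wirtinger :: "'n \<Rightarrow> (complex ^ 'n \<Rightarrow> complex) \<Rightarrow> complex ^ 'n \<Rightarrow> complex" where
  "wirtinger j f z =
     (partial_deriv (axis j 1) f z - \<i> * partial_deriv (axis j \<i>) f z) / 2"

definition wirtinger_bar :: "'n \<Rightarrow> (complex ^ 'n \<Rightarrow> complex) \<Rightarrow> complex ^ 'n \<Rightarrow> complex" where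
  "wirtinger_bar j f z =
     (partial_deriv (axis j 1) f z + \<i> * partial_deriv (axis j \<i>) f z) / 2"

definition holomorphic_Cn :: "(complex ^ 'n \<Rightarrow> complex) \<Rightarrow> (complex ^ 'n) set \<Rightarrow> bool" where
  "holomorphic_Cn f S \<longleftrightarrow>
     (\<forall>z\<in>S. f differentiable (at z) \<and> (\<forall>j. wirtinger_bar j f z = 0))"

text \<open>The \<open>2n\<close> real coordinates of \<open>complex ^ 'n\<close> are indexed by \<open>'n + 'n\<close>:
  \<open>Inl j\<close> for the real part and \<open>Inr j\<close> for the imaginary part of the \<open>j\<close>-th coordinate.\<close>

definition real_dir :: "'n + 'n \<Rightarrow> complex ^ 'n" where
  "real_dir a = (case a of Inl j \<Rightarrow> axis j 1 | Inr j \<Rightarrow> axis j \<i>)"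

definition real_jacobian :: "(complex ^ 'n \<Rightarrow> complex ^ 'n) \<Rightarrow> complex ^ 'n \<Rightarrow> real" where
  "real_jacobian f z =
     det (\<chi> a b. partial_deriv (real_dir b) f z \<bullet> real_dir a :: real ^ ('n + 'n) ^ ('n + 'n))"

section \<open>Strongly pseudoconvex domains\<close>

definition domain_Cn :: "(complex ^ 'n) set \<Rightarrow> bool" where
  "domain_Cn \<Omega> \<longleftrightarrow> open \<Omega> \<and> connected \<Omega> \<and> \<Omega> \<noteq> {}"

definition smooth_defining_function ::
    "(complex ^ 'n \<Rightarrow> real) \<Rightarrow> (complex ^ 'n) set \<Rightarrow> bool" where
  "smooth_defining_function r \<Omega> \<longleftrightarrow>
     (\<exists>W. open W \<and> closure \<Omega> \<subseteq> W \<and> smooth_on W r \<and> \<Omega> = {z \<in> W. r z < 0} \<and>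
       (\<forall>z\<in>W. r z = 0 \<longrightarrow> frechet_derivative r (at z) \<noteq> (\<lambda>_. 0)))"

definition smooth_bounded :: "(complex ^ 'n) set \<Rightarrow> bool" where
  "smooth_bounded \<Omega> \<longleftrightarrow> bounded \<Omega> \<and> (\<exists>r. smooth_defining_function r \<Omega>)"

definition complex_differential ::
    "(complex ^ 'n \<Rightarrow> real) \<Rightarrow> complex ^ 'n \<Rightarrow> complex ^ 'n \<Rightarrow> complex" where
  "complex_differential r p \<xi> = (\<Sum>j\<in>UNIV. wirtinger j (\<lambda>z. of_real (r z)) p * \<xi> $ j)"

text \<open>The Hermitian form of the mixed second derivatives; its value is real for \<open>r\<close> of class
  \<open>C\<^sup>2\<close>, so taking the real part only changes the type.\<close>

definition levi_form :: "(complex ^ 'n \<Rightarrow> real) \<Rightarrow> complex ^ 'n \<Rightarrow> complex ^ 'n \<Rightarrow> real" where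
  "levi_form r p \<xi> =
     Re (\<Sum>j\<in>UNIV. \<Sum>k\<in>UNIV.
       wirtinger j (wirtinger_bar k (\<lambda>z. of_real (r z))) p * \<xi> $ j * cnj (\<xi> $ k))"

definition strongly_pseudoconvex :: "(complex ^ 'n) set \<Rightarrow> bool" where
  "strongly_pseudoconvex \<Omega> \<longleftrightarrow>
     (\<exists>r. smooth_defining_function r \<Omega> \<and>
       (\<forall>p\<in>frontier \<Omega>. \<forall>\<xi>. \<xi> \<noteq> 0 \<and> complex_differential r p \<xi> = 0 \<longrightarrow> levi_form r p \<xi> > 0))"

section \<open>Bergman space, projection and kernel\<close>

definition L2_space :: "(complex ^ 'n) set \<Rightarrow> (complex ^ 'n \<Rightarrow> complex) set" where
  "L2_space \<Omega> = {f. f \<in> borel_measurable (lebesgue_on \<Omega>) \<and>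
     integrable (lebesgue_on \<Omega>) (\<lambda>z. (norm (f z))\<^sup>2)}"

definition L2_norm :: "(complex ^ 'n) set \<Rightarrow> (complex ^ 'n \<Rightarrow> complex) \<Rightarrow> real" where
  "L2_norm \<Omega> f = sqrt (\<integral>z. (norm (f z))\<^sup>2 \<partial>lebesgue_on \<Omega>)"

definition L2_inner ::
    "(complex ^ 'n) set \<Rightarrow> (complex ^ 'n \<Rightarrow> complex) \<Rightarrow> (complex ^ 'n \<Rightarrow> complex) \<Rightarrow> complex" where
  "L2_inner \<Omega> f g = (\<integral>z. f z * cnj (g z) \<partial>lebesgue_on \<Omega>)"

text \<open>A function on \<open>\<Omega>\<close> is represented by its extension by zero, so that equality in the Bergman
  space is equality of functions on \<open>\<Omega>\<close> and the definite descriptions below are unique.\<close>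

definition bergman_space :: "(complex ^ 'n) set \<Rightarrow> (complex ^ 'n \<Rightarrow> complex) set" where
  "bergman_space \<Omega> = {f. holomorphic_Cn f \<Omega> \<and> f \<in> L2_space \<Omega> \<and> (\<forall>z. z \<notin> \<Omega> \<longrightarrow> f z = 0)}"

definition bergman_projection ::
    "(complex ^ 'n) set \<Rightarrow> (complex ^ 'n \<Rightarrow> complex) \<Rightarrow> complex ^ 'n \<Rightarrow> complex" where
  "bergman_projection \<Omega> g =
     (THE h. h \<in> bergman_space \<Omega> \<and>
       (\<forall>u\<in>bergman_space \<Omega>. L2_inner \<Omega> (\<lambda>z. g z - h z) u = 0))"

text \<open>Convention: \<open>B(z,w)\<close> is holomorphic in \<open>z\<close>, and \<open>B(\<cdot>,w)\<close> represents evaluation at \<open>w \<in> \<Omega>\<close>.\<close>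

definition bergman_kernel ::
    "(complex ^ 'n) set \<Rightarrow> complex ^ 'n \<Rightarrow> complex ^ 'n \<Rightarrow> complex" where
  "bergman_kernel \<Omega> z w =
     (THE h. h \<in> bergman_space \<Omega> \<and> (\<forall>f\<in>bergman_space \<Omega>. f w = L2_inner \<Omega> f h)) z"

definition normalized_bergman_kernel ::
    "(complex ^ 'n) set \<Rightarrow> complex ^ 'n \<Rightarrow> complex ^ 'n \<Rightarrow> complex" where
  "normalized_bergman_kernel \<Omega> z w = bergman_kernel \<Omega> z w / csqrt (bergman_kernel \<Omega> z z)"

definition K_op ::
    "(complex ^ 'n) set \<Rightarrow> (complex ^ 'n \<Rightarrow> complex ^ 'n) \<Rightarrow> (complex ^ 'n \<Rightarrow> complex) \<Rightarrow>
      complex ^ 'n \<Rightarrow> complex" where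
  "K_op \<Omega> \<phi> f = bergman_projection \<Omega> (f \<circ> \<phi>)"

definition K_op_bounded :: "(complex ^ 'n) set \<Rightarrow> (complex ^ 'n \<Rightarrow> complex ^ 'n) \<Rightarrow> bool" where
  "K_op_bounded \<Omega> \<phi> \<longleftrightarrow>
     (\<forall>f\<in>bergman_space \<Omega>. f \<circ> \<phi> \<in> L2_space \<Omega>) \<and>
     (\<exists>C>0. \<forall>f\<in>bergman_space \<Omega>. L2_norm \<Omega> (K_op \<Omega> \<phi> f) \<le> C * L2_norm \<Omega> f)"

end

(* Both sides of the equivalence always hold, because f o phi is square-integrable with norm at most
   C ||f|| for every f in A^2(Omega).  Near F the map phi is injective with Jacobian bounded
   below, so a change of variables bounds the integral of |f o phi|^2 by a multiple of ||f||^2.  The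
   rest of Omega is mapped into a compact subset of Omega, on which point evaluations are uniformly
   bounded.  Boundedness of K_phi follows since the projection is a contraction, and finiteness of
   the supremum by applying the bound to normalized kernels. *)

theory Submission
  imports Defs "HOL-Complex_Analysis.Cauchy_Integral_Formula"
begin

section \<open>Change of variables in coordinates of a basis\<close>

text \<open>The obstacle is that projection and kernel are definite descriptions, so nothing can be
  said about them before two facts on the Bergman space are known: point evaluations are bounded,
  and the space is complete. Both rest on a sub-mean value inequality for |f|^2 on balls. It comes
  from averaging over the rotations u -> z + e^(it) (u - z): one-variable Cauchy theory applies on
  each complex line through z, and every rotation preserves volume. Completeness gives a Riesz
  theorem, hence existence of projection and kernel; bounded evaluations give their uniqueness.

  The compact set arises as follows. The extension of \<phi> can send a point of the closure to the
  boundary only if that point lies in \<open>F\<close>. Removing from the closure the points of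
  \<open>U\<close> with |Jacobian| above \<open>m / 2\<close> leaves a compact set that misses
  \<open>F\<close>, so its image is a compact subset of \<Omega>. The same threshold gives the lower
  bound for the Jacobian in the change of variables.\<close>

definition of_coords :: "('m::finite \<Rightarrow> 'a::euclidean_space) \<Rightarrow> real ^ 'm \<Rightarrow> 'a" where
  "of_coords b x = (\<Sum>i\<in>UNIV. (x $ i) *\<^sub>R b i)"

text \<open>When \<open>b\<close> enumerates \<open>Basis\<close>, this is the inverse of
  \<open>of_coords b\<close>; the two maps transport the change of variables from
  \<open>real ^ 'm\<close> to an arbitrary Euclidean space.\<close>

definition coords :: "('m::finite \<Rightarrow> 'a::euclidean_space) \<Rightarrow> 'a \<Rightarrow> real ^ 'm" where
  "coords b z = (\<chi> i. z \<bullet> b i)"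

lemma linear_of_coords: "linear (of_coords b)"
  unfolding of_coords_def
  by (intro linear_compose_sum ballI linearI) (auto simp: algebra_simps)

lemma linear_coords: "linear (coords b)"
  unfolding coords_def by (auto intro!: linearI simp: vec_eq_iff inner_simps)

context
  fixes b :: "'m::finite \<Rightarrow> 'a::euclidean_space"
  assumes b: "bij_betw b UNIV Basis"
begin

lemma inner_frame: "b i \<bullet> b j = (if i = j then 1 else 0)"
proof -
  have "b i \<in> Basis" "b j \<in> Basis" "b i = b j \<longleftrightarrow> i = j"
    using b by (auto simp: bij_betw_def inj_on_def)
  then show ?thesis
    by (simp add: inner_Basis)
qed

lemma coords_of_coords: "coords b (of_coords b x) = x"
  by (simp add: coords_def of_coords_def vec_eq_iff inner_sum_left inner_frame if_distrib cong: if_cong)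

lemma of_coords_inner: "of_coords b x \<bullet> b i = x $ i"
  using coords_of_coords[of x] by (simp add: coords_def vec_eq_iff)

lemma of_coords_coords: "of_coords b (coords b z) = z"
proof -
  have "of_coords b (coords b z) = (\<Sum>v\<in>Basis. (z \<bullet> v) *\<^sub>R v)"
    unfolding of_coords_def coords_def using b by (simp add: sum.reindex_bij_betw[of b UNIV Basis "\<lambda>v. (z \<bullet> v) *\<^sub>R v"])
  then show ?thesis
    by (simp add: euclidean_representation)
qed

lemma continuous_on_of_coords [continuous_intros]: "continuous_on A (of_coords b)"
  by (simp add: linear_continuous_on linear_of_coords linear_conv_bounded_linear[symmetric])

text \<open>Lebesgue measure is determined by its values on boxes, and the preimage of a box is a
  box with the same side lengths, merely indexed by \<open>'m\<close> instead of by basis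
  vectors.\<close>

lemma lborel_distr_of_coords: "distr lborel borel (of_coords b) = lborel"
proof (rule sym, rule lborel_eqI)
  fix l u :: 'a
  assume le: "\<And>v. v \<in> Basis \<Longrightarrow> l \<bullet> v \<le> u \<bullet> v"
  have [measurable]: "of_coords b \<in> borel_measurable borel"
    by (intro borel_measurable_continuous_onI continuous_on_of_coords)
  have Bas: "Basis = range b"
    using b by (simp add: bij_betw_def)
  have "of_coords b -` box l u = box (coords b l) (coords b u)"
    by (auto simp: box_def Bas of_coords_inner coords_def Basis_vec_def inner_axis)
  then have "emeasure (distr lborel borel (of_coords b)) (box l u) = emeasure lborel (box (coords b l) (coords b u))"
    by (subst emeasure_distr) auto
  also have "\<dots> = (\<Prod>v\<in>Basis. (coords b u - coords b l) \<bullet> v)"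
    by (rule emeasure_lborel_box) (use le in \<open>auto simp: Basis_vec_def inner_axis coords_def Bas\<close>)
  also have "(\<Prod>v\<in>Basis. (coords b u - coords b l) \<bullet> v) = (\<Prod>i\<in>UNIV. (u - l) \<bullet> b i)"
  proof -
    have "bij_betw (\<lambda>i::'m. axis i (1::real)) UNIV Basis"
      by (auto simp: bij_betw_def inj_on_def axis_eq_axis Basis_vec_def)
    then show ?thesis
      by (subst prod.reindex_bij_betw[symmetric]) (auto simp: inner_axis coords_def inner_simps)
  qed
  also have "\<dots> = (\<Prod>v\<in>Basis. (u - l) \<bullet> v)"
    using prod.reindex_bij_betw[OF b, of "\<lambda>v. (u - l) \<bullet> v"] by simp
  finally show "emeasure (distr lborel borel (of_coords b)) (box l u) = (\<Prod>v\<in>Basis. (u - l) \<bullet> v)" .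
qed simp

lemma nn_integral_of_coords:
  assumes [measurable]: "f \<in> borel_measurable borel"
  shows "(\<integral>\<^sup>+x. f (of_coords b x) \<partial>lborel) = (\<integral>\<^sup>+z. f z \<partial>lborel)"
proof -
  have [measurable]: "of_coords b \<in> borel_measurable borel"
    by (intro borel_measurable_continuous_onI continuous_on_of_coords)
  show ?thesis
    by (subst lborel_distr_of_coords[symmetric], subst nn_integral_distr) auto
qed

end

text \<open>Change of variables turns the integral of |det| times the composite into the integral of
  \<open>g\<close> over the image of \<open>S\<close>; then the determinant is bounded below by
  \<open>c\<close> and the image is enlarged to the whole space. With a nonnegative integral on the
  left, integrability of the composite is a consequence rather than a hypothesis.\<close>

lemma nn_integral_injective_image_le_cart:
  fixes g :: "real ^ 'm::{finite,wellorder} \<Rightarrow> real"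
  assumes S: "open S"
    and der: "\<And>x. x \<in> S \<Longrightarrow> (\<phi> has_derivative \<phi>' x) (at x)"
    and inj: "inj_on \<phi> S"
    and det: "\<And>x. x \<in> S \<Longrightarrow> c \<le> \<bar>det (matrix (\<phi>' x))\<bar>"
    and c: "c > 0"
    and int: "integrable lborel g" and nn: "\<And>x. g x \<ge> 0"
  shows "ennreal c * (\<integral>\<^sup>+x. indicator S x * ennreal (g (\<phi> x)) \<partial>lborel) \<le> (\<integral>\<^sup>+x. ennreal (g x) \<partial>lborel)"
proof -
  have [measurable]: "g \<in> borel_measurable borel"
    using int by auto
  have cont: "continuous_on S \<phi>"
    using der by (meson continuous_at_imp_continuous_on has_derivative_continuous)
  \<comment> \<open>Invariance of domain makes the image open, hence measurable.\<close>
  have opn: "open (\<phi> ` S)"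
    using invariance_of_domain[OF cont S inj] .
  define d where "d x = \<bar>det (matrix (\<phi>' x))\<bar>" for x
  \<comment> \<open>The change of variables theorem speaks of functions with values in some
    \<open>real ^ 'k\<close>, so \<open>g\<close> is viewed as a function into
    \<open>real ^ 1\<close>.\<close>
  define f where "f x = (vec (g x) :: real ^ 1)" for x
  have g_abs: "g absolutely_integrable_on (\<phi> ` S)"
  proof (rule set_integrable_subset)
    show "g absolutely_integrable_on UNIV"
      using int by (simp add: set_integrable_def integrable_completion)
  qed (use opn in \<open>auto intro: borel_open\<close>)
  then have f_abs: "f absolutely_integrable_on (\<phi> ` S)"
    by (simp add: f_def absolutely_integrable_on_1_iff)
  have der': "(\<phi> has_derivative \<phi>' x) (at x within S)" if "x \<in> S" for x
    using der[OF that] by (rule has_derivative_at_withinI)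
  have "(\<lambda>x. d x *\<^sub>R f (\<phi> x)) absolutely_integrable_on S \<and>
      integral S (\<lambda>x. d x *\<^sub>R f (\<phi> x)) = integral (\<phi> ` S) f"
    unfolding d_def using has_absolute_integral_change_of_variables[OF _ der' inj, of f] f_abs S by auto
  then have abs: "(\<lambda>x. d x * g (\<phi> x)) absolutely_integrable_on S"
    and eq: "integral S (\<lambda>x. d x * g (\<phi> x)) = integral (\<phi> ` S) g"
    by (auto simp: f_def absolutely_integrable_on_1_iff integral_on_1_eq vec_eq_iff)
  have [measurable]: "S \<in> sets borel" "\<phi> ` S \<in> sets borel"
    using S opn by auto
  have meas: "(\<lambda>x. indicator S x * ennreal (g (\<phi> x))) \<in> borel_measurable borel"
  proof -
    \<comment> \<open>Nothing is known about \<phi> outside \<open>S\<close>, so it is set to zero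
      there; the factor \<open>indicator S x\<close> hides the change.\<close>
    have "(\<lambda>x. indicator S x *\<^sub>R \<phi> x) \<in> borel_measurable borel"
      using borel_measurable_continuous_on_indicator[OF _ cont] by simp
    then have *: "(\<lambda>x. indicator S x * ennreal (g (indicator S x *\<^sub>R \<phi> x))) \<in> borel_measurable borel"
      by measurable
    have "(\<lambda>x. indicator S x * ennreal (g (indicator S x *\<^sub>R \<phi> x))) = (\<lambda>x. indicator S x * ennreal (g (\<phi> x)))"
      by (auto simp: indicator_def)
    with * show ?thesis by simp
  qed
  have "ennreal c * (\<integral>\<^sup>+x. indicator S x * ennreal (g (\<phi> x)) \<partial>lborel) =
      (\<integral>\<^sup>+x. ennreal c * (indicator S x * ennreal (g (\<phi> x))) \<partial>lebesgue)"
    using meas by (subst nn_integral_cmult[symmetric]) (auto simp: nn_integral_completion)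
  also have "\<dots> \<le> (\<integral>\<^sup>+x. ennreal (indicator S x *\<^sub>R (d x * g (\<phi> x))) \<partial>lebesgue)"
    by (intro nn_integral_mono)
      (use det c nn in \<open>auto simp: indicator_def d_def ennreal_mult[symmetric] intro!: ennreal_leI mult_right_mono\<close>)
  also have "\<dots> = ennreal (integral\<^sup>L lebesgue (\<lambda>x. indicator S x *\<^sub>R (d x * g (\<phi> x))))"
    by (intro nn_integral_eq_integral)
      (use abs nn in \<open>auto simp: set_integrable_def d_def indicator_def\<close>)
  also have "integral\<^sup>L lebesgue (\<lambda>x. indicator S x *\<^sub>R (d x * g (\<phi> x))) = integral S (\<lambda>x. d x * g (\<phi> x))"
    using set_lebesgue_integral_eq_integral(2)[OF abs] by (simp add: set_lebesgue_integral_def)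
  also have "\<dots> = integral\<^sup>L lebesgue (\<lambda>x. indicator (\<phi> ` S) x *\<^sub>R g x)"
    using set_lebesgue_integral_eq_integral(2)[OF g_abs] eq by (simp add: set_lebesgue_integral_def)
  also have "ennreal \<dots> = (\<integral>\<^sup>+x. ennreal (indicator (\<phi> ` S) x *\<^sub>R g x) \<partial>lebesgue)"
    by (intro nn_integral_eq_integral[symmetric])
      (use g_abs nn in \<open>auto simp: set_integrable_def indicator_def\<close>)
  also have "\<dots> \<le> (\<integral>\<^sup>+x. ennreal (g x) \<partial>lebesgue)"
    by (intro nn_integral_mono) (auto simp: indicator_def nn)
  also have "\<dots> = (\<integral>\<^sup>+x. ennreal (g x) \<partial>lborel)"
    by (subst nn_integral_completion) auto
  finally show ?thesis .
qed

text \<open>Conjugation with the coordinate maps reduces this to \<open>real ^ 'm\<close>: they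
  preserve Lebesgue measure, and the matrix of the conjugated derivative has exactly the entries in
  the hypothesis on the determinant.\<close>

lemma nn_integral_injective_image_le:
  fixes g :: "'a::euclidean_space \<Rightarrow> real" and b :: "'m::{finite,wellorder} \<Rightarrow> 'a"
  assumes b: "bij_betw b UNIV Basis"
    and S: "open S"
    and der: "\<And>x. x \<in> S \<Longrightarrow> (\<phi> has_derivative \<phi>' x) (at x)"
    and inj: "inj_on \<phi> S"
    and det: "\<And>x. x \<in> S \<Longrightarrow> c \<le> \<bar>det (\<chi> i j. \<phi>' x (b j) \<bullet> b i)\<bar>"
    and c: "c > 0"
    and int: "integrable lborel g" and nn: "\<And>x. g x \<ge> 0"
  shows "ennreal c * (\<integral>\<^sup>+x. indicator S x * ennreal (g (\<phi> x)) \<partial>lborel) \<le> (\<integral>\<^sup>+x. ennreal (g x) \<partial>lborel)"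
proof -
  have [measurable]: "g \<in> borel_measurable borel" "S \<in> sets borel"
    using int S by auto
  let ?T = "of_coords b" and ?C = "coords b"
  have bl: "bounded_linear ?T" "bounded_linear ?C"
    by (simp_all add: linear_conv_bounded_linear[symmetric] linear_of_coords linear_coords)
  have [measurable]: "?T \<in> borel_measurable borel"
    by (intro borel_measurable_continuous_onI continuous_on_of_coords b)
  have cont: "continuous_on S \<phi>"
    using der by (meson continuous_at_imp_continuous_on has_derivative_continuous)
  have meas: "(\<lambda>x. indicator S x * ennreal (g (\<phi> x))) \<in> borel_measurable borel"
  proof -
    have "(\<lambda>x. indicator S x *\<^sub>R \<phi> x) \<in> borel_measurable borel"
      using borel_measurable_continuous_on_indicator[OF _ cont] by simp
    then have *: "(\<lambda>x. indicator S x * ennreal (g (indicator S x *\<^sub>R \<phi> x))) \<in> borel_measurable borel"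
      by measurable
    have "(\<lambda>x. indicator S x * ennreal (g (indicator S x *\<^sub>R \<phi> x))) = (\<lambda>x. indicator S x * ennreal (g (\<phi> x)))"
      by (auto simp: indicator_def)
    with * show ?thesis by simp
  qed
  have "ennreal c * (\<integral>\<^sup>+x. indicator S x * ennreal (g (\<phi> x)) \<partial>lborel) =
     ennreal c * (\<integral>\<^sup>+x. indicator (?T -` S) x * ennreal ((g \<circ> ?T) ((?C \<circ> \<phi> \<circ> ?T) x)) \<partial>lborel)"
    using nn_integral_of_coords[OF b meas] by (simp add: of_coords_coords[OF b] indicator_def)
  also have "\<dots> \<le> (\<integral>\<^sup>+x. ennreal ((g \<circ> ?T) x) \<partial>lborel)"
  proof (rule nn_integral_injective_image_le_cart[where \<phi>' = "\<lambda>x. ?C \<circ> \<phi>' (?T x) \<circ> ?T"])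
    show "open (?T -` S)"
      by (intro open_vimage S continuous_on_of_coords b)
    show "((?C \<circ> \<phi> \<circ> ?T) has_derivative ?C \<circ> \<phi>' (?T x) \<circ> ?T) (at x)" if "x \<in> ?T -` S" for x
      using that by (intro diff_chain_at bounded_linear_imp_has_derivative bl) (auto intro: der)
    show "inj_on (?C \<circ> \<phi> \<circ> ?T) (?T -` S)"
      using inj by (auto simp: inj_on_def) (metis coords_of_coords[OF b] of_coords_coords[OF b])
    show "c \<le> \<bar>det (matrix (?C \<circ> \<phi>' (?T x) \<circ> ?T))\<bar>" if "x \<in> ?T -` S" for x
    proof -
      have "?T (axis j 1) = b j" for j
        by (simp add: of_coords_def axis_def if_distrib[of "\<lambda>r. r *\<^sub>R _"] cong: if_cong)
      then have "matrix (?C \<circ> \<phi>' (?T x) \<circ> ?T) = (\<chi> i j. \<phi>' (?T x) (b j) \<bullet> b i)"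
        by (simp add: matrix_def coords_def)
      with det[of "?T x"] that show ?thesis by simp
    qed
    show "integrable lborel (g \<circ> ?T)"
    proof -
      have "integrable (distr lborel borel ?T) g"
        by (simp add: lborel_distr_of_coords[OF b] int)
      then show ?thesis
        by (subst (asm) integrable_distr_eq) (auto simp: o_def)
    qed
  qed (use c nn in auto)
  also have "\<dots> = (\<integral>\<^sup>+x. ennreal (g x) \<partial>lborel)"
    using nn_integral_of_coords[OF b, of "\<lambda>x. ennreal (g x)"] by simp
  finally show ?thesis .
qed

section \<open>Determinants under relabelling and in orthonormal frames\<close>

lemma det_reindex:
  fixes A :: "'a::comm_ring_1 ^ 'n ^ 'n" and \<sigma> :: "'m::finite \<Rightarrow> 'n::finite"
  assumes "bij \<sigma>"
  shows "det (\<chi> i j. A $ \<sigma> i $ \<sigma> j) = det A"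
proof -
  have inj: "inj \<sigma>" and b: "bij_betw \<sigma> UNIV UNIV"
    using assms by (auto simp: bij_def)
  \<comment> \<open>Relabelling rows and columns by \<sigma> conjugates the permutations in the
    Leibniz formula by \<sigma>. This is a bijection of permutations that keeps signs, so the sum is
    only reordered.\<close>
  have bij: "bij_betw (map_permutation UNIV \<sigma>) {p. p permutes UNIV} {p. p permutes UNIV}"
  proof -
    have "map_permutation UNIV \<sigma> p x = \<sigma> (p (inv \<sigma> x))" for p x
      using map_permutation_apply[OF inj, of "inv \<sigma> x" p] assms by (simp add: bij_is_surj surj_f_inv_f)
    then have "map_permutation UNIV \<sigma> = (\<lambda>p x. \<sigma> (p (inv \<sigma> x)))"
      by (intro ext)
    then show ?thesis
      using bij_betw_permutations[OF b] by simp
  qed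
  have app: "map_permutation UNIV \<sigma> p (\<sigma> i) = \<sigma> (p i)" for p i
    by (rule map_permutation_apply[OF inj]) simp
  have "det A = (\<Sum>p\<in>{p. p permutes UNIV}. of_int (sign (map_permutation UNIV \<sigma> p)) *
      (\<Prod>i\<in>UNIV. A $ i $ map_permutation UNIV \<sigma> p i))"
    unfolding det_def by (rule sum.reindex_bij_betw[OF bij, symmetric])
  also have "\<dots> = (\<Sum>p\<in>{p. p permutes UNIV}. of_int (sign p) * (\<Prod>i\<in>UNIV. A $ \<sigma> i $ \<sigma> (p i)))"
  proof (intro sum.cong refl, goal_cases)
    case (1 p)
    have "sign (map_permutation UNIV \<sigma> p) = sign p"
      by (rule sign_map_permutation[OF inj]) (use 1 in auto)
    moreover have "(\<Prod>i\<in>UNIV. A $ i $ map_permutation UNIV \<sigma> p i) = (\<Prod>i\<in>UNIV. A $ \<sigma> i $ \<sigma> (p i))"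
      by (subst prod.reindex_bij_betw[OF b, symmetric]) (simp add: app)
    ultimately show ?case by simp
  qed
  finally show ?thesis
    by (simp add: det_def)
qed

lemma real_dir_bij: "bij_betw (real_dir :: 'n + 'n \<Rightarrow> complex ^ 'n) UNIV Basis"
proof -
  have "x \<in> range real_dir" if x: "x \<in> Basis" for x :: "complex ^ 'n"
  proof -
    obtain j u where "x = axis j u" "u \<in> Basis"
      using x unfolding Basis_vec_def by blast
    then have "x = real_dir (Inl j) \<or> x = real_dir (Inr j)"
      by (auto simp: real_dir_def Basis_complex_def)
    then show ?thesis by auto
  qed
  then show ?thesis
    by (auto simp: bij_betw_def inj_on_def real_dir_def axis_eq_axis Basis_complex_def split: sum.splits)
qed

text \<open>The change of variables theorem needs a well-ordered index type; \<open>'n bit0\<close> is one with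
  \<open>2 * CARD('n)\<close> elements.\<close>

lemma ex_bij_bit0_sum: "\<exists>\<sigma> :: 'n::finite bit0 \<Rightarrow> 'n + 'n. bij \<sigma>"
  using finite_same_card_bij[of "UNIV :: 'n bit0 set" "UNIV :: ('n + 'n) set"]
  by (auto simp: card_Plus UNIV_Plus_UNIV[symmetric] simp del: UNIV_Plus_UNIV)

lemma real_frame_det:
  fixes \<sigma> :: "'n::finite bit0 \<Rightarrow> 'n + 'n"
  assumes "bij \<sigma>"
  shows "det (\<chi> i j. L (real_dir (\<sigma> j)) \<bullet> (real_dir (\<sigma> i) :: complex ^ 'n)) =
    det (\<chi> i j. L (real_dir j) \<bullet> (real_dir i :: complex ^ 'n))"
  using det_reindex[OF assms, of "\<chi> i j. L (real_dir j) \<bullet> (real_dir i :: complex ^ 'n)"] by simp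

text \<open>The columns are the coordinates of the orthonormal vectors \<open>R (b j)\<close> in an
  orthonormal basis, so the matrix is orthogonal. This supplies the Jacobian in
  \<open>nn_integral_rotate_le\<close>.\<close>

lemma det_orthogonal_frame:
  fixes b :: "'m::finite \<Rightarrow> 'a::euclidean_space"
  assumes b: "bij_betw b UNIV Basis" and R: "orthogonal_transformation R"
  shows "\<bar>det (\<chi> i j. R (b j) \<bullet> b i)\<bar> = 1"
proof -
  let ?A = "\<chi> i j. R (b j) \<bullet> b i"
  have "transpose ?A ** ?A = mat 1"
  proof -
    have "(\<Sum>k\<in>UNIV. (R (b i) \<bullet> b k) * (R (b j) \<bullet> b k)) = (if i = j then 1 else 0)" for i j
    proof -
      have "(\<Sum>k\<in>UNIV. (R (b i) \<bullet> b k) * (R (b j) \<bullet> b k)) = R (b i) \<bullet> R (b j)"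
        using sum.reindex_bij_betw[OF b, of "\<lambda>v. (R (b i) \<bullet> v) * (R (b j) \<bullet> v)"]
        by (simp add: euclidean_inner[of "R (b i)" "R (b j)"])
      also have "\<dots> = b i \<bullet> b j"
        using R by (simp add: orthogonal_transformation_def)
      finally show ?thesis by (simp add: inner_frame[OF b])
    qed
    then show ?thesis
      by (simp add: vec_eq_iff matrix_matrix_mult_def transpose_def mat_def)
  qed
  then have "orthogonal_matrix ?A"
    by (simp add: orthogonal_matrix)
  from det_orthogonal_matrix[OF this] show ?thesis by auto
qed

section \<open>Holomorphic functions of several variables\<close>

lemma axis_decompose: "(axis j c :: complex ^ 'n) = Re c *\<^sub>R axis j 1 + Im c *\<^sub>R axis j \<i>"
  by (auto simp: vec_eq_iff axis_def complex_eq_iff)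

lemma vec_eq_sum_axis: "(u :: complex ^ 'n) = (\<Sum>j\<in>UNIV. axis j (u $ j))"
  by (simp add: vec_eq_iff axis_def if_distrib cong: if_cong)

text \<open>The Cauchy-Riemann equations, read coordinate by coordinate, give compatibility with
  \<i> only on the axes. As the vectors \<open>axis j 1\<close> and \<open>axis j \<i>\<close> span
  over the reals, the derivative is complex linear.\<close>

lemma linear_cmult:
  fixes L :: "complex ^ 'n \<Rightarrow> complex"
  assumes L: "linear L" and i: "\<And>j. L (axis j \<i>) = \<i> * L (axis j 1)"
  shows "L (c *s u) = c * L u"
proof -
  have ax: "L (axis j a) = a * L (axis j 1)" for j a
  proof -
    have "L (axis j a) = of_real (Re a) * L (axis j 1) + of_real (Im a) * (\<i> * L (axis j 1))"
      unfolding axis_decompose[of j a] linear_add[OF L] linear_scale[OF L] i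
      unfolding scaleR_conv_of_real ..
    also have "\<dots> = (of_real (Re a) + \<i> * of_real (Im a)) * L (axis j 1)"
      by (simp add: algebra_simps)
    finally show ?thesis
      by (simp only: complex_eq[symmetric])
  qed
  have sumL: "L v = (\<Sum>j\<in>UNIV. v $ j * L (axis j 1))" for v
  proof -
    have "L v = (\<Sum>j\<in>UNIV. L (axis j (v $ j)))"
      using linear_sum[OF L, of "\<lambda>j. axis j (v $ j)" UNIV] by (simp only: vec_eq_sum_axis[symmetric])
    also have "\<dots> = (\<Sum>j\<in>UNIV. v $ j * L (axis j 1))"
      by (intro sum.cong refl ax)
    finally show ?thesis .
  qed
  show ?thesis
    by (simp add: sumL[of "c *s u"] sumL[of u] sum_distrib_left mult.assoc)
qed

lemma wirtinger_bar_eq_0_iff: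
  "wirtinger_bar j f z = 0 \<longleftrightarrow>
    frechet_derivative f (at z) (axis j \<i>) = \<i> * frechet_derivative f (at z) (axis j 1)"
  unfolding wirtinger_bar_def partial_deriv_def
  by (auto simp: complex_eq_iff)

lemma holomorphic_Cn_has_derivative:
  assumes "holomorphic_Cn f S" "z \<in> S"
  shows "(f has_derivative frechet_derivative f (at z)) (at z)"
  using assms unfolding holomorphic_Cn_def by (auto simp: frechet_derivative_works)

lemma holomorphic_Cn_cmult:
  assumes "holomorphic_Cn f S" "z \<in> S"
  shows "frechet_derivative f (at z) (c *s u) = c * frechet_derivative f (at z) u"
proof (rule linear_cmult)
  show "linear (frechet_derivative f (at z))"
    using holomorphic_Cn_has_derivative[OF assms] by (rule has_derivative_linear)
  show "frechet_derivative f (at z) (axis j \<i>) = \<i> * frechet_derivative f (at z) (axis j 1)" for j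
    using assms unfolding holomorphic_Cn_def by (auto simp: wirtinger_bar_eq_0_iff)
qed

lemma holomorphic_CnI:
  assumes "\<And>z. z \<in> S \<Longrightarrow> (f has_derivative f' z) (at z)"
    and "\<And>z j. z \<in> S \<Longrightarrow> f' z (axis j \<i>) = \<i> * f' z (axis j 1)"
  shows "holomorphic_Cn f S"
proof -
  have "frechet_derivative f (at z) = f' z" if "z \<in> S" for z
    using frechet_derivative_at[OF assms(1)[OF that]] by simp
  then show ?thesis
    using assms by (auto simp: holomorphic_Cn_def wirtinger_bar_eq_0_iff differentiable_def)
qed

lemma bounded_linear_smult_left: "bounded_linear (\<lambda>c::complex. c *s (u :: complex ^ 'n))"
  by (simp add: linear_conv_bounded_linear[symmetric]) (auto intro!: linearI simp: vec_eq_iff algebra_simps)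

lemma bounded_linear_smult_right: "bounded_linear ((*s) c :: complex ^ 'n \<Rightarrow> _)"
  by (simp add: linear_conv_bounded_linear[symmetric]) (auto intro!: linearI simp: vec_eq_iff algebra_simps)

lemma norm_smult: "norm (c *s (u :: complex ^ 'n)) = cmod c * norm u"
  by (simp add: norm_vec_def norm_mult L2_set_right_distrib)

text \<open>By complex linearity of the derivative, the chain rule along a complex line yields
  multiplication by a complex number. All one-variable theory enters through this
  restriction.\<close>

lemma holomorphic_Cn_line:
  assumes f: "holomorphic_Cn f S" and z: "z + c *s u \<in> S"
  shows "((\<lambda>c. f (z + c *s u)) has_field_derivative frechet_derivative f (at (z + c *s u)) u) (at c)"
proof -
  have "((\<lambda>c. z + c *s u) has_derivative (\<lambda>c. c *s u)) (at c)"
    using bounded_linear_imp_has_derivative[OF bounded_linear_smult_left[of u]]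
    by (auto intro!: derivative_eq_intros)
  from diff_chain_at[OF this holomorphic_Cn_has_derivative[OF f z]]
  show ?thesis
    by (simp add: has_field_derivative_def o_def holomorphic_Cn_cmult[OF f z] mult.commute[of _ "frechet_derivative _ _ _"])
qed

lemma holomorphic_Cn_line_holomorphic:
  assumes f: "holomorphic_Cn f S" and "\<And>c. c \<in> A \<Longrightarrow> z + c *s u \<in> S"
  shows "(\<lambda>c. f (z + c *s u)) holomorphic_on A"
  unfolding holomorphic_on_def field_differentiable_def
  using holomorphic_Cn_line[OF f assms(2)] has_field_derivative_at_within by blast

lemma holomorphic_Cn_continuous_on:
  assumes "holomorphic_Cn f S"
  shows "continuous_on S f"
  using holomorphic_Cn_has_derivative[OF assms]
  by (meson continuous_at_imp_continuous_on has_derivative_continuous)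

section \<open>Mean values on circles and the sub-mean value inequality on balls\<close>

lemma holomorphic_mean_value:
  assumes h: "h holomorphic_on A" and A: "open A" "cball 0 1 \<subseteq> A"
  shows "((\<lambda>t. h (cis (2 * pi * t))) has_integral h 0) {0..1}"
proof -
  have "h holomorphic_on cball 0 1"
    using h A holomorphic_on_subset by blast
  from Cauchy_integral_circlepath_simple[OF this, of 0]
  have "((\<lambda>x. h (circlepath 0 1 x) / circlepath 0 1 x * vector_derivative (circlepath 0 1) (at x within {0..1}))
      has_integral 2 * of_real pi * \<i> * h 0) {0..1}"
    by (simp add: has_contour_integral_def)
  \<comment> \<open>The derivative of the circle path is 2 pi i times the point of the circle, so it
    cancels the Cauchy denominator.\<close>
  then have "((\<lambda>x. (2 * of_real pi * \<i>) * h (cis (2 * pi * x))) has_integral 2 * of_real pi * \<i> * h 0) {0..1}"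
  proof (rule has_integral_eq[rotated])
    fix x :: real assume "x \<in> {0..1}"
    then have "vector_derivative (circlepath 0 1) (at x within {0..1}) = 2 * of_real pi * \<i> * circlepath 0 1 x"
      by (simp add: vector_derivative_circlepath01) (simp add: circlepath)
    moreover have "circlepath 0 1 x = cis (2 * pi * x)"
      by (simp add: circlepath cis_conv_exp mult_ac)
    ultimately show "h (circlepath 0 1 x) / circlepath 0 1 x * vector_derivative (circlepath 0 1) (at x within {0..1}) =
        (2 * of_real pi * \<i>) * h (cis (2 * pi * x))"
      by simp
  qed
  from has_integral_mult_right[OF this, of "inverse (2 * of_real pi * \<i>)"]
  show ?thesis by (simp add: field_simps)
qed

text \<open>The mean value property is applied to the holomorphic function g^2 instead of g, so that
  the bound for |g|^2 is just the triangle inequality for integrals.\<close>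

lemma holomorphic_submean:
  assumes g: "g holomorphic_on A" and A: "open A" "cball 0 1 \<subseteq> A"
  shows "ennreal ((norm (g 0))\<^sup>2) \<le> (\<integral>\<^sup>+t. indicator {0..1} t * ennreal ((norm (g (cis (2 * pi * t))))\<^sup>2) \<partial>lborel)"
proof -
  define h where "h t = (g (cis (2 * pi * t)))\<^sup>2" for t
  have "(h has_integral (g 0)\<^sup>2) {0..1}"
    unfolding h_def by (rule holomorphic_mean_value[where h = "\<lambda>x. (g x)\<^sup>2"]) (use g A in \<open>auto intro!: holomorphic_intros\<close>)
  moreover have "continuous_on {0..1} h"
  proof -
    have "continuous_on (cball 0 1) g"
      using g A holomorphic_on_imp_continuous_on continuous_on_subset by blast
    moreover have "continuous_on {0..1} (\<lambda>t. cis (2 * pi * t))"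
      by (intro continuous_intros)
    ultimately have "continuous_on {0..1} (\<lambda>t. g (cis (2 * pi * t)))"
      by (rule continuous_on_compose2) auto
    then show ?thesis
      unfolding h_def by (rule continuous_on_power)
  qed
  ultimately have int: "set_integrable lborel {0..1} h" "set_integrable lborel {0..1} (\<lambda>t. norm (h t))"
    and eq: "(g 0)\<^sup>2 = integral {0..1} h"
    by (blast intro: borel_integrable_atLeastAtMost' continuous_on_norm integral_unique[symmetric])+
  have "(norm (g 0))\<^sup>2 = norm (LINT t:{0..1}|lborel. h t)"
    using set_borel_integral_eq_integral(2)[OF int(1)] eq by (metis norm_power)
  also have "\<dots> \<le> (LINT t|lborel. norm (indicator {0..1} t *\<^sub>R h t))"
    unfolding set_lebesgue_integral_def by (rule integral_norm_bound)
  finally have "ennreal ((norm (g 0))\<^sup>2) \<le> ennreal (LINT t|lborel. norm (indicator {0..1} t *\<^sub>R h t))"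
    by (rule ennreal_leI)
  also have "\<dots> = (\<integral>\<^sup>+t. ennreal (norm (indicator {0..1} t *\<^sub>R h t)) \<partial>lborel)"
    using int by (intro nn_integral_eq_integral[symmetric]) (auto simp: set_integrable_def)
  also have "\<dots> = (\<integral>\<^sup>+t. indicator {0..1} t * ennreal ((norm (g (cis (2 * pi * t))))\<^sup>2) \<partial>lborel)"
    by (intro nn_integral_cong) (auto simp: indicator_def h_def norm_power)
  finally show ?thesis .
qed

text \<open>Multiplication by a unimodular scalar is an orthogonal map, so the change of variables
  holds with constant 1.\<close>

lemma nn_integral_rotate_le:
  fixes f :: "complex ^ 'n \<Rightarrow> complex"
  assumes int: "integrable lborel (\<lambda>z. (norm (f z))\<^sup>2)" and S: "open S" and c: "cmod c = 1"
  shows "(\<integral>\<^sup>+u. indicator S u * ennreal ((norm (f (z + c *s (u - z))))\<^sup>2) \<partial>lborel) \<le> (\<integral>\<^sup>+u. ennreal ((norm (f u))\<^sup>2) \<partial>lborel)"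
proof -
  obtain \<sigma> :: "'n bit0 \<Rightarrow> 'n + 'n" where \<sigma>: "bij \<sigma>"
    using ex_bij_bit0_sum by blast
  have b: "bij_betw (real_dir \<circ> \<sigma>) UNIV (Basis :: (complex ^ 'n) set)"
    using bij_betw_trans[OF \<sigma> real_dir_bij] .
  have orth: "orthogonal_transformation ((*s) c :: complex ^ 'n \<Rightarrow> _)"
    using bounded_linear_smult_right[of c] c
    by (simp add: orthogonal_transformation norm_smult linear_conv_bounded_linear)
  have "ennreal 1 * (\<integral>\<^sup>+u. indicator S u * ennreal ((norm (f (z + c *s (u - z))))\<^sup>2) \<partial>lborel) \<le> (\<integral>\<^sup>+u. ennreal ((norm (f u))\<^sup>2) \<partial>lborel)"
  proof (rule nn_integral_injective_image_le[OF b S _ _ _ _ int, where \<phi>' = "\<lambda>_. (*s) c"])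
    show "((\<lambda>u. z + c *s (u - z)) has_derivative (*s) c) (at x)" for x
      by (rule derivative_eq_intros bounded_linear.has_derivative[OF bounded_linear_smult_right] refl | simp)+
    show "inj_on (\<lambda>u. z + c *s (u - z)) S"
      using c by (auto simp: inj_on_def)
    show "1 \<le> \<bar>det (\<chi> i j. (c *s (real_dir \<circ> \<sigma>) j) \<bullet> (real_dir \<circ> \<sigma>) i)\<bar>" for x
      using det_orthogonal_frame[OF b orth] by simp
  qed auto
  then show ?thesis by simp
qed

text \<open>For each u in the ball, c -> f(z + c(u - z)) is holomorphic near the closed unit disc
  and equals f(z) at 0, so |f(z)|^2 is at most the mean of its squared modulus over the unit circle.
  Integrating over u and exchanging the integrals leaves, for each angle, an integral over a rotated
  ball, which the whole integral dominates.\<close>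

lemma submean_value_ball:
  fixes f :: "complex ^ 'n \<Rightarrow> complex"
  assumes f: "holomorphic_Cn f S" and ball: "ball z r \<subseteq> S"
    and int: "integrable lborel (\<lambda>z. (norm (f z))\<^sup>2)"
    and [measurable]: "f \<in> borel_measurable borel"
  shows "ennreal ((norm (f z))\<^sup>2) * emeasure lborel (ball z r) \<le> (\<integral>\<^sup>+u. ennreal ((norm (f u))\<^sup>2) \<partial>lborel)"
proof -
  \<comment> \<open>Multiples of \<open>u - z\<close> must stay unexpanded to match the form
    \<open>z + c *s v\<close> of a point on a complex line.\<close>
  note vector_ssub_ldistrib [simp del]
  define F where "F u t = indicator (ball z r) u * (indicator {0..1} t * ennreal ((norm (f (z + cis (2 * pi * t) *s (u - z))))\<^sup>2))"
    for u :: "complex ^ 'n" and t :: real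
  have pt: "ennreal ((norm (f z))\<^sup>2) \<le> (\<integral>\<^sup>+t. indicator {0..1} t * ennreal ((norm (f (z + cis (2 * pi * t) *s (u - z))))\<^sup>2) \<partial>lborel)"
    if u: "u \<in> ball z r" for u
  proof -
    \<comment> \<open>All scalars that keep the point on the line inside the ball: an open set, and
      it contains the closed unit disc because \<open>u\<close> lies in the open ball.\<close>
    define A where "A = {c::complex. norm (c *s (u - z)) < r}"
    have "open A"
      unfolding A_def norm_smult by (intro open_Collect_less continuous_intros)
    moreover have "cball 0 1 \<subseteq> A"
    proof
      fix c :: complex assume "c \<in> cball 0 1"
      then have "cmod c * norm (u - z) \<le> norm (u - z)"
        by (intro mult_left_le_one_le) auto
      with u show "c \<in> A"
        unfolding A_def norm_smult mem_Collect_eq by (simp add: dist_norm norm_minus_commute)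
    qed
    moreover have "(\<lambda>c. f (z + c *s (u - z))) holomorphic_on A"
      by (rule holomorphic_Cn_line_holomorphic[OF f]) (use ball in \<open>auto simp: A_def dist_norm simp del: vector_ssub_ldistrib\<close>)
    ultimately show ?thesis
      using holomorphic_submean[of "\<lambda>c. f (z + c *s (u - z))" A]
      by (simp only: vector_smult_lzero add_0_right)
  qed
  \<comment> \<open>Exchanging the integrals requires joint measurability, which follows since
    \<open>G\<close> is continuous in both variables together.\<close>
  define G where "G x = z + cis (2 * pi * snd x) *s (fst x - z)" for x :: "(complex ^ 'n) \<times> real"
  have [measurable]: "G \<in> borel_measurable borel"
    unfolding G_def vector_scalar_mult_def
    by (intro borel_measurable_continuous_onI continuous_intros)
  have F_G: "(\<lambda>(u, t). F u t) = (\<lambda>x. indicator (ball z r) (fst x) * (indicator {0..1} (snd x) * ennreal ((norm (f (G x)))\<^sup>2)))"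
    by (auto simp: F_def G_def)
  have F_meas: "(\<lambda>(u, t). F u t) \<in> borel_measurable (lborel \<Otimes>\<^sub>M lborel)"
  proof -
    have [measurable]: "ball z r \<in> sets borel"
      by simp
    have "(\<lambda>x. indicator (ball z r) (fst x) * (indicator {0..1} (snd x) * ennreal ((norm (f (G x)))\<^sup>2))) \<in> borel_measurable borel"
      unfolding borel_prod[symmetric] by (measurable; simp add: borel_prod)
    then show ?thesis
      by (simp add: F_G lborel_prod)
  qed
  have "ennreal ((norm (f z))\<^sup>2) * emeasure lborel (ball z r) = (\<integral>\<^sup>+u. ennreal ((norm (f z))\<^sup>2) * indicator (ball z r) u \<partial>lborel)"
    by (simp add: nn_integral_cmult_indicator)
  also have "\<dots> \<le> (\<integral>\<^sup>+u. (\<integral>\<^sup>+t. F u t \<partial>lborel) \<partial>lborel)"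
  proof (intro nn_integral_mono)
    fix u
    show "ennreal ((norm (f z))\<^sup>2) * indicator (ball z r) u \<le> (\<integral>\<^sup>+t. F u t \<partial>lborel)"
    proof (cases "u \<in> ball z r")
      case True
      with pt[OF True] show ?thesis
        by (simp only: F_def indicator_simps mult_1 mult_1_right)
    qed simp
  qed
  also have "\<dots> = (\<integral>\<^sup>+t. (\<integral>\<^sup>+u. F u t \<partial>lborel) \<partial>lborel)"
    by (rule lborel_pair.Fubini'[OF F_meas, symmetric])
  also have "\<dots> \<le> (\<integral>\<^sup>+t. (\<integral>\<^sup>+u. ennreal ((norm (f u))\<^sup>2) \<partial>lborel) * indicator {0..1::real} t \<partial>lborel)"
  proof (intro nn_integral_mono)
    fix t :: real
    show "(\<integral>\<^sup>+u. F u t \<partial>lborel) \<le> (\<integral>\<^sup>+u. ennreal ((norm (f u))\<^sup>2) \<partial>lborel) * indicator {0..1} t"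
    proof (cases "t \<in> {0..1}")
      case True
      with nn_integral_rotate_le[OF int open_ball norm_cis, of z r z "2 * pi * t"] show ?thesis
        by (simp only: F_def indicator_simps mult_1 mult_1_right)
    qed (simp add: F_def)
  qed
  also have "\<dots> = (\<integral>\<^sup>+u. ennreal ((norm (f u))\<^sup>2) \<partial>lborel)"
    by (simp add: nn_integral_cmult_indicator)
  finally show ?thesis .
qed

section \<open>Cauchy estimates and locally uniform limits\<close>

lemma holomorphic_Cn_derivative_bound:
  assumes f: "holomorphic_Cn f S" and \<rho>: "0 < \<rho>" "cball z \<rho> \<subseteq> S"
    and B: "\<And>w. w \<in> cball z \<rho> \<Longrightarrow> norm (f w) \<le> B"
  shows "norm (frechet_derivative f (at z) v) \<le> B / \<rho> * norm v"
proof (cases "v = 0")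
  case True
  have "linear (frechet_derivative f (at z))"
    using f \<rho> by (intro has_derivative_linear[OF holomorphic_Cn_has_derivative]) auto
  then show ?thesis
    using True by (simp add: linear_0)
next
  case False
  \<comment> \<open>The largest radius for which c -> z + c v maps the closed disc into
    \<open>cball z \<rho>\<close>; Cauchy's inequality on that disc gives the bound in direction
    \<open>v\<close>.\<close>
  define R where "R = \<rho> / norm v"
  have R: "R > 0" "R * norm v = \<rho>"
    using False \<rho> by (auto simp: R_def)
  have in_ball: "z + c *s v \<in> cball z \<rho>" if "c \<in> cball 0 R" for c
  proof -
    have "cmod c * norm v \<le> R * norm v"
      using that by (intro mult_right_mono) auto
    then show ?thesis
      by (simp add: dist_norm norm_smult R)
  qed
  have hol: "(\<lambda>c. f (z + c *s v)) holomorphic_on cball 0 R"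
    by (rule holomorphic_Cn_line_holomorphic[OF f]) (use in_ball \<rho> in blast)
  have "norm ((deriv ^^ 1) (\<lambda>c. f (z + c *s v)) 0) \<le> fact 1 * B / R ^ 1"
  proof (rule Cauchy_inequality)
    show "(\<lambda>c. f (z + c *s v)) holomorphic_on ball 0 R"
      using hol holomorphic_on_subset ball_subset_cball by blast
    show "continuous_on (cball 0 R) (\<lambda>c. f (z + c *s v))"
      using hol by (rule holomorphic_on_imp_continuous_on)
    show "norm (f (z + c *s v)) \<le> B" if "norm (0 - c) = R" for c
      by (rule B[OF in_ball]) (use that in simp)
  qed (use R in auto)
  moreover have "deriv (\<lambda>c. f (z + c *s v)) 0 = frechet_derivative f (at z) v"
  proof -
    have "z \<in> cball z \<rho>"
      using \<rho> by simp
    then have "z + 0 *s v \<in> S"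
      using \<rho> by auto
    from DERIV_imp_deriv[OF holomorphic_Cn_line[OF f this]] show ?thesis
      by simp
  qed
  ultimately show ?thesis
    by (simp add: R_def)
qed

lemma frechet_derivative_diff_holomorphic:
  assumes f: "holomorphic_Cn f S" and g: "holomorphic_Cn g S" and z: "z \<in> S"
  shows "frechet_derivative (\<lambda>w. f w - g w) (at z) v = frechet_derivative f (at z) v - frechet_derivative g (at z) v"
  using frechet_derivative_at[OF has_derivative_diff[OF holomorphic_Cn_has_derivative[OF f z] holomorphic_Cn_has_derivative[OF g z]]]
  by (metis (no_types))

lemma holomorphic_Cn_add_cmult:
  assumes f: "holomorphic_Cn f S" and g: "holomorphic_Cn g S"
  shows "holomorphic_Cn (\<lambda>w. f w + c * g w) S"
proof (rule holomorphic_CnI)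
  fix z assume z: "z \<in> S"
  show "((\<lambda>w. f w + c * g w) has_derivative
      (\<lambda>v. frechet_derivative f (at z) v + c * frechet_derivative g (at z) v)) (at z)"
    by (intro has_derivative_add has_derivative_mult_right holomorphic_Cn_has_derivative[OF f z]
        holomorphic_Cn_has_derivative[OF g z])
  show "frechet_derivative f (at z) (axis j \<i>) + c * frechet_derivative g (at z) (axis j \<i>) =
      \<i> * (frechet_derivative f (at z) (axis j 1) + c * frechet_derivative g (at z) (axis j 1))" for j
    using f g z by (simp add: holomorphic_Cn_def wirtinger_bar_eq_0_iff algebra_simps)
qed

lemma holomorphic_Cn_diff:
  assumes "holomorphic_Cn f S" "holomorphic_Cn g S"
  shows "holomorphic_Cn (\<lambda>w. f w - g w) S"
  using holomorphic_Cn_add_cmult[OF assms, of "-1"] by simp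

text \<open>By Cauchy's estimate the derivatives are uniformly Cauchy on a smaller ball.\<close>

lemma holomorphic_Cn_uniform_Cauchy_limit:
  fixes h :: "nat \<Rightarrow> complex ^ 'n \<Rightarrow> complex"
  assumes h: "\<And>n. holomorphic_Cn (h n) S" and \<rho>: "0 < \<rho>" "cball z0 (2 * \<rho>) \<subseteq> S"
    and cauchy: "uniformly_Cauchy_on (cball z0 (2 * \<rho>)) h"
    and lim: "\<And>z. z \<in> cball z0 (2 * \<rho>) \<Longrightarrow> (\<lambda>n. h n z) \<longlonglongrightarrow> g z"
  shows "holomorphic_Cn g (ball z0 \<rho>)"
proof -
  define D where "D n z = frechet_derivative (h n) (at z)" for n z
  \<comment> \<open>Cauchy's estimate at a point of the small ball uses a ball of radius \<rho>
    about that point; this is why control on radius \<open>2 * \<rho>\<close> is assumed.\<close>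
  have sub: "cball z \<rho> \<subseteq> cball z0 (2 * \<rho>)" if "z \<in> ball z0 \<rho>" for z
    using that by (intro cball_subset_cball_iff[THEN iffD2]) (auto simp: dist_commute)
  have in_S: "z \<in> S" if "z \<in> ball z0 \<rho>" for z
  proof -
    have "z \<in> cball z \<rho>"
      using \<rho> by simp
    then show ?thesis
      using sub[OF that] \<rho> by blast
  qed
  have est: "\<exists>N. \<forall>m\<ge>N. \<forall>n\<ge>N. \<forall>z\<in>ball z0 \<rho>. \<forall>v. norm (D m z v - D n z v) \<le> e * norm v"
    if e: "e > 0" for e
  proof -
    obtain N where N: "\<And>m n z. m \<ge> N \<Longrightarrow> n \<ge> N \<Longrightarrow> z \<in> cball z0 (2 * \<rho>) \<Longrightarrow> dist (h m z) (h n z) < e * \<rho>"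
      using cauchy e \<rho> unfolding uniformly_Cauchy_on_def by (metis mult_pos_pos)
    have "norm (D m z v - D n z v) \<le> e * norm v" if "m \<ge> N" "n \<ge> N" and z: "z \<in> ball z0 \<rho>" for m n z v
    proof -
      have "norm (frechet_derivative (\<lambda>w. h m w - h n w) (at z) v) \<le> e * \<rho> / \<rho> * norm v"
      proof (rule holomorphic_Cn_derivative_bound[OF holomorphic_Cn_diff[OF h h] \<rho>(1)])
        show "cball z \<rho> \<subseteq> S"
          using sub[OF z] \<rho> by blast
        show "norm (h m w - h n w) \<le> e * \<rho>" if "w \<in> cball z \<rho>" for w
          using N[OF \<open>m \<ge> N\<close> \<open>n \<ge> N\<close>, of w] sub[OF z] that by (auto simp: dist_norm)
      qed
      then show ?thesis
        using \<rho> by (simp add: D_def frechet_derivative_diff_holomorphic[OF h h in_S[OF z]])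
    qed
    then show ?thesis by blast
  qed
  define g' where "g' z v = lim (\<lambda>n. D n z v)" for z v
  have D_lim: "(\<lambda>n. D n z v) \<longlonglongrightarrow> g' z v" if z: "z \<in> ball z0 \<rho>" for z v
  proof -
    have "Cauchy (\<lambda>n. D n z v)"
    proof (rule metric_CauchyI)
      fix e :: real assume e: "0 < e"
      \<comment> \<open>The summand 1 covers \<open>v = 0\<close>, and the factor 2 makes the final
        inequality strict.\<close>
      then have "0 < e / (2 * (norm v + 1))"
        by (simp add: add_nonneg_pos)
      from est[OF this] obtain N where N: "\<And>m n. m \<ge> N \<Longrightarrow> n \<ge> N \<Longrightarrow> norm (D m z v - D n z v) \<le> e / (2 * (norm v + 1)) * norm v"
        using z by blast
      have "e / (2 * (norm v + 1)) * norm v = e / 2 * (norm v / (norm v + 1))"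
        by simp
      also have "\<dots> \<le> e / 2 * 1"
        using e by (intro mult_left_mono) (auto simp: divide_le_eq add_nonneg_pos)
      also have "\<dots> < e"
        using e by simp
      finally show "\<exists>M. \<forall>m\<ge>M. \<forall>n\<ge>M. dist (D m z v) (D n z v) < e"
        using N by (auto simp: dist_norm intro: le_less_trans)
    qed
    then show ?thesis
      unfolding g'_def by (simp add: Cauchy_convergent_iff convergent_LIMSEQ_iff)
  qed
  have hder: "(h n has_derivative D n z) (at z within ball z0 \<rho>)" if "z \<in> ball z0 \<rho>" for n z
    unfolding D_def
    by (rule has_derivative_at_withinI[OF holomorphic_Cn_has_derivative[OF h in_S[OF that]]])
  have unif: "\<forall>\<^sub>F n in sequentially. \<forall>z\<in>ball z0 \<rho>. \<forall>v. norm (D n z v - g' z v) \<le> e * norm v" if e: "e > 0" for e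
  proof -
    from est[OF e] obtain N where N: "\<And>m n z v. m \<ge> N \<Longrightarrow> n \<ge> N \<Longrightarrow> z \<in> ball z0 \<rho> \<Longrightarrow> norm (D m z v - D n z v) \<le> e * norm v"
      by blast
    \<comment> \<open>Letting \<open>m\<close> tend to infinity in the Cauchy estimate keeps the
      same \<open>N\<close>, valid for all \<open>z\<close> and \<open>v\<close>.\<close>
    have "norm (D n z v - g' z v) \<le> e * norm v" if "n \<ge> N" "z \<in> ball z0 \<rho>" for n z v
    proof (rule tendsto_upperbound)
      show "(\<lambda>m. norm (D n z v - D m z v)) \<longlonglongrightarrow> norm (D n z v - g' z v)"
        using D_lim[OF that(2)] by (intro tendsto_intros)
      show "\<forall>\<^sub>F m in sequentially. norm (D n z v - D m z v) \<le> e * norm v"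
        using N that by (intro eventually_sequentiallyI[of N]) auto
    qed simp
    then show ?thesis
      by (intro eventually_sequentiallyI[of N]) blast
  qed
  \<comment> \<open>Differentiation of sequences yields some limit function \<open>k\<close>;
    uniqueness of limits then identifies it with \<open>g\<close> on the ball.\<close>
  have "\<exists>k. \<forall>z\<in>ball z0 \<rho>. (\<lambda>n. h n z) \<longlonglongrightarrow> k z \<and> (k has_derivative g' z) (at z within ball z0 \<rho>)"
    by (rule has_derivative_sequence[OF convex_ball hder unif, of z0 "g z0"]) (use \<rho> lim in auto)
  then obtain k where k: "\<And>z. z \<in> ball z0 \<rho> \<Longrightarrow> (\<lambda>n. h n z) \<longlonglongrightarrow> k z"
    "\<And>z. z \<in> ball z0 \<rho> \<Longrightarrow> (k has_derivative g' z) (at z within ball z0 \<rho>)"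
    by blast
  have kg: "k z = g z" if "z \<in> ball z0 \<rho>" for z
    using LIMSEQ_unique[OF k(1)[OF that] lim] that \<rho> by auto
  show ?thesis
  proof (rule holomorphic_CnI)
    fix z assume z: "z \<in> ball z0 \<rho>"
    have "(g has_derivative g' z) (at z within ball z0 \<rho>)"
      using k(2)[OF z] by (rule has_derivative_transform[OF z kg[symmetric], rotated])
    then show "(g has_derivative g' z) (at z)"
      using z at_within_open[OF z open_ball] by simp
    fix j
    have "D n z (axis j \<i>) = \<i> * D n z (axis j 1)" for n
      using h[of n] in_S[OF z] by (simp add: D_def holomorphic_Cn_def wirtinger_bar_eq_0_iff)
    then have "(\<lambda>n. D n z (axis j \<i>)) \<longlonglongrightarrow> \<i> * g' z (axis j 1)"
      using D_lim[OF z, of "axis j 1"] by (auto intro!: tendsto_intros)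
    with D_lim[OF z, of "axis j \<i>"] show "g' z (axis j \<i>) = \<i> * g' z (axis j 1)"
      by (rule LIMSEQ_unique)
  qed
qed

section \<open>Square-integrable functions\<close>

lemma L2_norm_nonneg [simp]: "0 \<le> L2_norm \<Omega> f"
  by (simp add: L2_norm_def)

lemma L2_norm_square: "(L2_norm \<Omega> f)\<^sup>2 = (\<integral>z. (norm (f z))\<^sup>2 \<partial>lebesgue_on \<Omega>)"
  by (simp add: L2_norm_def)

lemma nn_integral_L2_norm:
  assumes "f \<in> L2_space \<Omega>"
  shows "(\<integral>\<^sup>+z. ennreal ((norm (f z))\<^sup>2) \<partial>lebesgue_on \<Omega>) = ennreal ((L2_norm \<Omega> f)\<^sup>2)"
  unfolding L2_norm_square by (rule nn_integral_eq_integral) (use assms in \<open>auto simp: L2_space_def\<close>)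

lemma L2_spaceI_nn_integral:
  assumes "f \<in> borel_measurable (lebesgue_on \<Omega>)"
    and "(\<integral>\<^sup>+z. ennreal ((norm (f z))\<^sup>2) \<partial>lebesgue_on \<Omega>) < \<infinity>"
  shows "f \<in> L2_space \<Omega>"
  using assms by (auto simp: L2_space_def integrable_iff_bounded)

lemma L2_norm_leI:
  assumes "f \<in> L2_space \<Omega>" "0 \<le> C"
    and "(\<integral>\<^sup>+z. ennreal ((norm (f z))\<^sup>2) \<partial>lebesgue_on \<Omega>) \<le> ennreal (C\<^sup>2)"
  shows "L2_norm \<Omega> f \<le> C"
proof -
  have "(L2_norm \<Omega> f)\<^sup>2 \<le> C\<^sup>2"
    using assms(3) unfolding nn_integral_L2_norm[OF assms(1)] by simp
  then show ?thesis
    using assms(2) by (rule power2_le_imp_le)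
qed

text \<open>Here and in the analogous lemmas below, closure under f + c g is the only form proved
  directly: c = -1 gives differences and, in the Bergman space, f = 0 gives multiples.\<close>

lemma L2_add_cmult:
  assumes "f \<in> L2_space \<Omega>" "g \<in> L2_space \<Omega>"
  shows "(\<lambda>z. f z + c * g z) \<in> L2_space \<Omega>"
proof -
  have [measurable]: "f \<in> borel_measurable (lebesgue_on \<Omega>)" "g \<in> borel_measurable (lebesgue_on \<Omega>)"
    using assms by (auto simp: L2_space_def)
  have bound: "(norm (f z + c * g z))\<^sup>2 \<le> 2 * (norm (f z))\<^sup>2 + 2 * (cmod c)\<^sup>2 * (norm (g z))\<^sup>2" for z
  proof -
    have "(norm (f z + c * g z))\<^sup>2 \<le> (norm (f z) + norm (c * g z))\<^sup>2"
      by (intro power_mono norm_triangle_ineq) auto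
    also have "\<dots> \<le> 2 * (norm (f z))\<^sup>2 + 2 * (norm (c * g z))\<^sup>2"
      using sum_squares_bound[of "norm (f z)" "norm (c * g z)"] by (simp add: power2_sum)
    finally show ?thesis
      by (simp add: norm_mult power_mult_distrib)
  qed
  have "integrable (lebesgue_on \<Omega>) (\<lambda>z. (norm (f z + c * g z))\<^sup>2)"
    by (rule Bochner_Integration.integrable_bound[of _ "\<lambda>z. 2 * (norm (f z))\<^sup>2 + 2 * (cmod c)\<^sup>2 * (norm (g z))\<^sup>2"])
      (use assms bound in \<open>auto simp: L2_space_def\<close>)
  then show ?thesis
    by (simp add: L2_space_def)
qed

lemma L2_diff:
  assumes "f \<in> L2_space \<Omega>" "g \<in> L2_space \<Omega>"
  shows "(\<lambda>z. f z - g z) \<in> L2_space \<Omega>"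
  using L2_add_cmult[OF assms, of "-1"] by simp

lemma L2_inner_integrable:
  assumes "f \<in> L2_space \<Omega>" "g \<in> L2_space \<Omega>"
  shows "integrable (lebesgue_on \<Omega>) (\<lambda>z. f z * cnj (g z))"
proof (rule Bochner_Integration.integrable_bound[of _ "\<lambda>z. (norm (f z))\<^sup>2 + (norm (g z))\<^sup>2"])
  have [measurable]: "f \<in> borel_measurable (lebesgue_on \<Omega>)" "g \<in> borel_measurable (lebesgue_on \<Omega>)"
    using assms by (auto simp: L2_space_def)
  have [measurable]: "cnj \<in> borel_measurable borel"
    by (intro borel_measurable_continuous_onI continuous_intros)
  show "(\<lambda>z. f z * cnj (g z)) \<in> borel_measurable (lebesgue_on \<Omega>)"
    by measurable
  show "AE z in lebesgue_on \<Omega>. norm (f z * cnj (g z)) \<le> norm ((norm (f z))\<^sup>2 + (norm (g z))\<^sup>2)"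
  proof (rule AE_I2)
    fix z
    have "2 * (norm (f z) * norm (g z)) \<le> (norm (f z))\<^sup>2 + (norm (g z))\<^sup>2"
      using sum_squares_bound[of "norm (f z)" "norm (g z)"] by simp
    moreover have "0 \<le> norm (f z) * norm (g z)"
      by simp
    ultimately have "norm (f z) * norm (g z) \<le> (norm (f z))\<^sup>2 + (norm (g z))\<^sup>2"
      by linarith
    then show "norm (f z * cnj (g z)) \<le> norm ((norm (f z))\<^sup>2 + (norm (g z))\<^sup>2)"
      by (simp add: norm_mult)
  qed
qed (use assms in \<open>auto simp: L2_space_def\<close>)

lemma L2_inner_add_cmult_left:
  assumes "f \<in> L2_space \<Omega>" "g \<in> L2_space \<Omega>" "h \<in> L2_space \<Omega>"
  shows "L2_inner \<Omega> (\<lambda>z. f z + c * g z) h = L2_inner \<Omega> f h + c * L2_inner \<Omega> g h"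
proof -
  have "L2_inner \<Omega> (\<lambda>z. f z + c * g z) h = (\<integral>z. f z * cnj (h z) + c * (g z * cnj (h z)) \<partial>lebesgue_on \<Omega>)"
    unfolding L2_inner_def by (simp add: algebra_simps)
  also have "\<dots> = L2_inner \<Omega> f h + c * L2_inner \<Omega> g h"
    unfolding L2_inner_def using L2_inner_integrable[OF assms(1,3)] L2_inner_integrable[OF assms(2,3)] by simp
  finally show ?thesis .
qed

lemma L2_inner_diff_left:
  assumes "f \<in> L2_space \<Omega>" "g \<in> L2_space \<Omega>" "h \<in> L2_space \<Omega>"
  shows "L2_inner \<Omega> (\<lambda>z. f z - g z) h = L2_inner \<Omega> f h - L2_inner \<Omega> g h"
  using L2_inner_add_cmult_left[OF assms, of "-1"] by simp

lemma L2_inner_commute: "L2_inner \<Omega> g f = cnj (L2_inner \<Omega> f g)"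
  unfolding L2_inner_def Bochner_Integration.integral_cnj[symmetric] by (simp add: mult.commute)

lemma L2_inner_self: "L2_inner \<Omega> f f = of_real ((L2_norm \<Omega> f)\<^sup>2)"
  unfolding L2_inner_def L2_norm_square complex_norm_square[symmetric] by (rule integral_complex_of_real)

text \<open>This one expansion serves as the parallelogram law (c = 1 and c = -1), as Pythagoras
  (orthogonal functions, c = 1), and as the variation of the functional minimized in
  \<open>bergman_Riesz\<close>.\<close>

lemma L2_norm_add_cmult:
  assumes "f \<in> L2_space \<Omega>" "g \<in> L2_space \<Omega>"
  shows "(L2_norm \<Omega> (\<lambda>z. f z + c * g z))\<^sup>2 =
    (L2_norm \<Omega> f)\<^sup>2 + 2 * Re (cnj c * L2_inner \<Omega> f g) + (cmod c)\<^sup>2 * (L2_norm \<Omega> g)\<^sup>2"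
proof -
  let ?s = "\<lambda>z. f z + c * g z"
  have s: "?s \<in> L2_space \<Omega>"
    by (rule L2_add_cmult[OF assms])
  have "L2_inner \<Omega> ?s ?s = L2_inner \<Omega> f ?s + c * L2_inner \<Omega> g ?s"
    by (rule L2_inner_add_cmult_left[OF assms s])
  also have "\<dots> = cnj (L2_inner \<Omega> ?s f) + c * cnj (L2_inner \<Omega> ?s g)"
    by (simp only: L2_inner_commute[of \<Omega> _ ?s])
  also have "\<dots> = L2_inner \<Omega> f f + cnj c * L2_inner \<Omega> f g + c * (cnj (L2_inner \<Omega> f g) + cnj c * L2_inner \<Omega> g g)"
    unfolding L2_inner_add_cmult_left[OF assms assms(1)] L2_inner_add_cmult_left[OF assms assms(2)]
      L2_inner_commute[of \<Omega> g f]
    by (simp add: L2_inner_self)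
  finally have "Re (L2_inner \<Omega> ?s ?s) = Re (L2_inner \<Omega> f f + cnj c * L2_inner \<Omega> f g + c * (cnj (L2_inner \<Omega> f g) + cnj c * L2_inner \<Omega> g g))"
    by simp
  then show ?thesis
    unfolding L2_inner_self by (simp add: cmod_def power2_eq_square algebra_simps)
qed

lemma L2_norm_cmult: "L2_norm \<Omega> (\<lambda>z. c * f z) = cmod c * L2_norm \<Omega> f"
  by (simp add: L2_norm_def norm_mult power_mult_distrib real_sqrt_mult)

lemma L2_Cauchy_Schwarz:
  assumes "f \<in> L2_space \<Omega>" "g \<in> L2_space \<Omega>"
  shows "cmod (L2_inner \<Omega> f g) \<le> L2_norm \<Omega> f * L2_norm \<Omega> g"
proof -
  have [measurable]: "f \<in> borel_measurable (lebesgue_on \<Omega>)" "g \<in> borel_measurable (lebesgue_on \<Omega>)"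
    using assms by (auto simp: L2_space_def)
  have "ennreal ((cmod (L2_inner \<Omega> f g))\<^sup>2) \<le> (\<integral>\<^sup>+z. ennreal (norm (f z * cnj (g z))) \<partial>lebesgue_on \<Omega>)\<^sup>2"
    unfolding ennreal_power[symmetric, OF norm_ge_zero]
    using integral_norm_bound_ennreal[OF L2_inner_integrable[OF assms]]
    by (intro power_mono) (auto simp: L2_inner_def)
  also have "\<dots> = (\<integral>\<^sup>+z. ennreal (norm (f z)) * ennreal (norm (g z)) \<partial>lebesgue_on \<Omega>)\<^sup>2"
    by (simp add: norm_mult ennreal_mult)
  also have "\<dots> \<le> (\<integral>\<^sup>+z. (ennreal (norm (f z)))\<^sup>2 \<partial>lebesgue_on \<Omega>) * (\<integral>\<^sup>+z. (ennreal (norm (g z)))\<^sup>2 \<partial>lebesgue_on \<Omega>)"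
    by (rule Cauchy_Schwarz_nn_integral) auto
  also have "\<dots> = ennreal ((L2_norm \<Omega> f * L2_norm \<Omega> g)\<^sup>2)"
    using nn_integral_L2_norm[OF assms(1)] nn_integral_L2_norm[OF assms(2)]
    by (simp add: ennreal_power power_mult_distrib ennreal_mult)
  finally have "(cmod (L2_inner \<Omega> f g))\<^sup>2 \<le> (L2_norm \<Omega> f * L2_norm \<Omega> g)\<^sup>2"
    by simp
  then show ?thesis
    by (rule power2_le_imp_le) simp
qed

section \<open>The Bergman space\<close>

lemma bergman_L2: "f \<in> bergman_space \<Omega> \<Longrightarrow> f \<in> L2_space \<Omega>"
  by (simp add: bergman_space_def)

lemma bergman_add_cmult:
  assumes "f \<in> bergman_space \<Omega>" "g \<in> bergman_space \<Omega>"
  shows "(\<lambda>z. f z + c * g z) \<in> bergman_space \<Omega>"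
  using assms L2_add_cmult[of f \<Omega> g c] holomorphic_Cn_add_cmult[of f \<Omega> g c]
  by (auto simp: bergman_space_def)

lemma bergman_diff:
  assumes "f \<in> bergman_space \<Omega>" "g \<in> bergman_space \<Omega>"
  shows "(\<lambda>z. f z - g z) \<in> bergman_space \<Omega>"
  using bergman_add_cmult[OF assms, of "-1"] by simp

lemma bergman_zero: "(\<lambda>z. 0) \<in> bergman_space \<Omega>"
  by (auto simp: bergman_space_def L2_space_def holomorphic_Cn_def wirtinger_bar_eq_0_iff frechet_derivative_const)

lemma bergman_cmult: "f \<in> bergman_space \<Omega> \<Longrightarrow> (\<lambda>z. c * f z) \<in> bergman_space \<Omega>"
  using bergman_add_cmult[OF bergman_zero, of f \<Omega> c] by simp

context
  fixes \<Omega> :: "(complex ^ 'n) set"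
  assumes open_\<Omega>: "open \<Omega>"
begin

section \<open>Point evaluations and completeness\<close>

lemma bergman_borel_measurable:
  assumes "f \<in> bergman_space \<Omega>"
  shows "f \<in> borel_measurable borel"
proof -
  have "continuous_on \<Omega> f" and zero: "\<And>z. z \<notin> \<Omega> \<Longrightarrow> f z = 0"
    using assms holomorphic_Cn_continuous_on by (auto simp: bergman_space_def)
  then have "(\<lambda>z. indicator \<Omega> z *\<^sub>R f z) \<in> borel_measurable borel"
    using open_\<Omega> by (intro borel_measurable_continuous_on_indicator) auto
  moreover have "(\<lambda>z. indicator \<Omega> z *\<^sub>R f z) = f"
    using zero by (auto simp: indicator_def)
  ultimately show ?thesis by simp
qed

lemma nn_integral_lebesgue_on:
  assumes "(\<lambda>z. indicator \<Omega> z * f z) \<in> borel_measurable borel"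
  shows "(\<integral>\<^sup>+z. f z \<partial>lebesgue_on \<Omega>) = (\<integral>\<^sup>+z. indicator \<Omega> z * f z \<partial>lborel)"
proof -
  have "(\<integral>\<^sup>+z. f z \<partial>lebesgue_on \<Omega>) = (\<integral>\<^sup>+z. f z * indicator \<Omega> z \<partial>lebesgue)"
    using open_\<Omega> by (subst nn_integral_restrict_space) auto
  also have "\<dots> = (\<integral>\<^sup>+z. indicator \<Omega> z * f z \<partial>lborel)"
    using assms by (simp add: nn_integral_completion mult.commute)
  finally show ?thesis .
qed

text \<open>Members of the space vanish off \<Omega>, so their norm is an integral over the whole
  space; this connects \<open>L2_norm\<close> to the inequalities stated for
  \<open>lborel\<close>.\<close>

lemma nn_integral_bergman:
  assumes f: "f \<in> bergman_space \<Omega>"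
  shows "(\<integral>\<^sup>+z. ennreal ((norm (f z))\<^sup>2) \<partial>lborel) = ennreal ((L2_norm \<Omega> f)\<^sup>2)"
proof -
  note [measurable] = bergman_borel_measurable[OF f]
  have \<Omega> [measurable]: "\<Omega> \<in> sets borel"
    using open_\<Omega> by simp
  have "ennreal ((L2_norm \<Omega> f)\<^sup>2) = (\<integral>\<^sup>+z. indicator \<Omega> z * ennreal ((norm (f z))\<^sup>2) \<partial>lborel)"
    unfolding nn_integral_L2_norm[OF bergman_L2[OF f], symmetric]
    by (rule nn_integral_lebesgue_on) measurable
  also have "\<dots> = (\<integral>\<^sup>+z. ennreal ((norm (f z))\<^sup>2) \<partial>lborel)"
    using f by (intro nn_integral_cong) (auto simp: indicator_def bergman_space_def)
  finally show ?thesis by simp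
qed

lemma bergman_integrable_lborel:
  assumes f: "f \<in> bergman_space \<Omega>"
  shows "integrable lborel (\<lambda>z. (norm (f z))\<^sup>2)"
  using bergman_borel_measurable[OF f] nn_integral_bergman[OF f] by (simp add: integrable_iff_bounded)

text \<open>Divide the sub-mean value inequality by the volume of the ball. The volume is written
  for the ball about 0 to make visible that the constant depends on \<open>r\<close> alone.\<close>

lemma bergman_sup_bound:
  assumes f: "f \<in> bergman_space \<Omega>" and r: "0 < r" "ball z r \<subseteq> \<Omega>"
  shows "norm (f z) \<le> L2_norm \<Omega> f / sqrt (measure lborel (ball (0::complex ^ 'n) r))"
proof -
  have vol: "emeasure lborel (ball z r) = ennreal (measure lborel (ball (0::complex ^ 'n) r))"
    using r by (simp add: emeasure_ball content_ball)
  have pos: "0 < measure lborel (ball (0::complex ^ 'n) r)"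
    using r by (simp add: content_ball_pos)
  have "ennreal ((norm (f z))\<^sup>2) * ennreal (measure lborel (ball (0::complex ^ 'n) r)) \<le> ennreal ((L2_norm \<Omega> f)\<^sup>2)"
    unfolding nn_integral_bergman[OF f, symmetric] vol[symmetric]
    by (rule submean_value_ball[OF _ r(2) bergman_integrable_lborel[OF f] bergman_borel_measurable[OF f]])
      (use f in \<open>simp add: bergman_space_def\<close>)
  then have "(norm (f z))\<^sup>2 * measure lborel (ball (0::complex ^ 'n) r) \<le> (L2_norm \<Omega> f)\<^sup>2"
    by (simp add: ennreal_mult[symmetric])
  then have "sqrt ((norm (f z))\<^sup>2 * measure lborel (ball (0::complex ^ 'n) r)) \<le> L2_norm \<Omega> f"
    by (intro real_le_lsqrt) auto
  then show ?thesis
    using pos by (simp add: real_sqrt_mult pos_le_divide_eq)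
qed

text \<open>One radius \<open>r\<close> fits at every point of a compact subset of \<Omega>, so one
  ball volume serves for all of them.\<close>

lemma bergman_compact_bound:
  assumes "compact L" "L \<subseteq> \<Omega>"
  obtains C where "0 < C" "\<And>f z. f \<in> bergman_space \<Omega> \<Longrightarrow> z \<in> L \<Longrightarrow> norm (f z) \<le> C * L2_norm \<Omega> f"
proof -
  obtain r where r: "0 < r" "(\<Union>x\<in>L. cball x r) \<subseteq> \<Omega>"
    using compact_subset_open_imp_cball_epsilon_subset[OF assms(1) open_\<Omega> assms(2)] by blast
  have pos: "0 < measure lborel (ball (0::complex ^ 'n) r)"
    using r by (simp add: content_ball_pos)
  show thesis
  proof
    show "0 < 1 / sqrt (measure lborel (ball (0::complex ^ 'n) r))"
      using pos by simp
    fix f :: "complex ^ 'n \<Rightarrow> complex" and z assume f: "f \<in> bergman_space \<Omega>" and z: "z \<in> L"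
    have "ball z r \<subseteq> \<Omega>"
      using r(2) z ball_subset_cball by fastforce
    from bergman_sup_bound[OF f r(1) this]
    show "norm (f z) \<le> 1 / sqrt (measure lborel (ball (0::complex ^ 'n) r)) * L2_norm \<Omega> f"
      by simp
  qed
qed

lemma bergman_eval_bound:
  assumes "z \<in> \<Omega>"
  obtains C where "0 < C" "\<And>f. f \<in> bergman_space \<Omega> \<Longrightarrow> norm (f z) \<le> C * L2_norm \<Omega> f"
  using bergman_compact_bound[of "{z}"] assms by (metis compact_sing empty_subsetI insert_subset singletonI)

text \<open>Bounded evaluations upgrade equality in norm to equality at every point, which is what
  uniqueness of the definite descriptions requires.\<close>

lemma bergman_eq_if_norm_diff_0:
  assumes "f \<in> bergman_space \<Omega>" "g \<in> bergman_space \<Omega>" "L2_norm \<Omega> (\<lambda>z. f z - g z) = 0"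
  shows "f = g"
proof
  fix z
  show "f z = g z"
  proof (cases "z \<in> \<Omega>")
    case True
    then obtain C where "\<And>f. f \<in> bergman_space \<Omega> \<Longrightarrow> norm (f z) \<le> C * L2_norm \<Omega> f"
      using bergman_eval_bound by metis
    from this[OF bergman_diff[OF assms(1,2)]] show ?thesis
      using assms(3) by simp
  qed (use assms in \<open>auto simp: bergman_space_def\<close>)
qed

text \<open>Bounded evaluations make a norm-Cauchy sequence uniformly Cauchy on compact sets, so the
  pointwise limit is holomorphic; Fatou's lemma then gives square-integrability and convergence in
  norm.\<close>

lemma bergman_complete:
  assumes h: "\<And>n. h n \<in> bergman_space \<Omega>"
    and cauchy: "\<And>e. e > 0 \<Longrightarrow> \<exists>N. \<forall>m\<ge>N. \<forall>n\<ge>N. L2_norm \<Omega> (\<lambda>z. h m z - h n z) \<le> e"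
  shows "\<exists>g\<in>bergman_space \<Omega>. (\<lambda>n. L2_norm \<Omega> (\<lambda>z. h n z - g z)) \<longlonglongrightarrow> 0"
proof -
  have hol: "holomorphic_Cn (h n) \<Omega>" and L2: "h n \<in> L2_space \<Omega>" for n
    using h by (auto simp: bergman_space_def)
  have unif: "uniformly_Cauchy_on L h" if L: "compact L" "L \<subseteq> \<Omega>" for L
  proof -
    obtain C where C: "0 < C" "\<And>f z. f \<in> bergman_space \<Omega> \<Longrightarrow> z \<in> L \<Longrightarrow> norm (f z) \<le> C * L2_norm \<Omega> f"
      using bergman_compact_bound[OF L] by metis
    show ?thesis
      unfolding uniformly_Cauchy_on_def
    proof (intro allI impI)
      fix e :: real assume e: "0 < e"
      then obtain N where N: "\<And>m n. m \<ge> N \<Longrightarrow> n \<ge> N \<Longrightarrow> L2_norm \<Omega> (\<lambda>z. h m z - h n z) \<le> e / (2 * C)"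
        using cauchy[of "e / (2 * C)"] C by (meson divide_pos_pos mult_pos_pos zero_less_numeral)
      have "dist (h m z) (h n z) < e" if "z \<in> L" "m \<ge> N" "n \<ge> N" for z m n
      proof -
        have "norm (h m z - h n z) \<le> C * L2_norm \<Omega> (\<lambda>z. h m z - h n z)"
          by (rule C(2)[OF bergman_diff[OF h h] that(1)])
        also have "\<dots> \<le> C * (e / (2 * C))"
          using C N that by (intro mult_left_mono) auto
        also have "\<dots> < e"
          using C e by simp
        finally show ?thesis by (simp add: dist_norm)
      qed
      then show "\<exists>M. \<forall>z\<in>L. \<forall>m\<ge>M. \<forall>n\<ge>M. dist (h m z) (h n z) < e"
        by blast
    qed
  qed
  define g where "g z = lim (\<lambda>n. h n z)" for z
  have lim: "(\<lambda>n. h n z) \<longlonglongrightarrow> g z" for z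
  proof (cases "z \<in> \<Omega>")
    case True
    then have "Cauchy (\<lambda>n. h n z)"
      using unif[of "{z}"] by (auto simp: uniformly_Cauchy_on_def Cauchy_def)
    then show ?thesis
      unfolding g_def by (simp add: Cauchy_convergent_iff convergent_LIMSEQ_iff)
  next
    case False
    then have "h n z = 0" for n
      using h by (auto simp: bergman_space_def)
    then show ?thesis
      by (simp add: g_def)
  qed
  have g_hol: "holomorphic_Cn g \<Omega>"
    unfolding holomorphic_Cn_def
  proof
    fix z0 assume "z0 \<in> \<Omega>"
    then obtain r where r: "r > 0" "cball z0 r \<subseteq> \<Omega>"
      using open_\<Omega> open_contains_cball by blast
    \<comment> \<open>The limit lemma halves the radius.\<close>
    have "holomorphic_Cn g (ball z0 (r / 2))"
      by (rule holomorphic_Cn_uniform_Cauchy_limit[OF hol]) (use r lim unif[OF compact_cball r(2)] in auto)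
    then show "g differentiable at z0 \<and> (\<forall>j. wirtinger_bar j g z0 = 0)"
      using r unfolding holomorphic_Cn_def by auto
  qed
  have g_meas [measurable]: "g \<in> borel_measurable (lebesgue_on \<Omega>)"
    using holomorphic_Cn_continuous_on[OF g_hol] open_\<Omega>
    by (intro continuous_imp_measurable_on_sets_lebesgue) auto
  have h_meas [measurable]: "h n \<in> borel_measurable (lebesgue_on \<Omega>)" for n
    using L2[of n] by (simp add: L2_space_def)
  \<comment> \<open>With \<open>n\<close> fixed, the second index of the Cauchy condition goes to
    infinity under the integral.\<close>
  have fatou: "(\<integral>\<^sup>+z. ennreal ((norm (h n z - g z))\<^sup>2) \<partial>lebesgue_on \<Omega>) \<le> ennreal (e\<^sup>2)"
    if e: "e > 0" and N: "\<And>m. m \<ge> N \<Longrightarrow> L2_norm \<Omega> (\<lambda>z. h n z - h m z) \<le> e" for n N e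
  proof -
    have "liminf (\<lambda>m. ennreal ((norm (h n z - h m z))\<^sup>2)) = ennreal ((norm (h n z - g z))\<^sup>2)" for z
      using lim[of z] by (intro lim_imp_Liminf tendsto_ennrealI tendsto_intros) auto
    then have "(\<integral>\<^sup>+z. ennreal ((norm (h n z - g z))\<^sup>2) \<partial>lebesgue_on \<Omega>) =
        (\<integral>\<^sup>+z. liminf (\<lambda>m. ennreal ((norm (h n z - h m z))\<^sup>2)) \<partial>lebesgue_on \<Omega>)"
      by simp
    also have "\<dots> \<le> liminf (\<lambda>m. \<integral>\<^sup>+z. ennreal ((norm (h n z - h m z))\<^sup>2) \<partial>lebesgue_on \<Omega>)"
      by (rule nn_integral_liminf) measurable
    also have "\<dots> \<le> liminf (\<lambda>m. ennreal (e\<^sup>2))"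
    proof (rule Liminf_mono, rule eventually_sequentiallyI)
      fix m assume "m \<ge> N"
      then show "(\<integral>\<^sup>+z. ennreal ((norm (h n z - h m z))\<^sup>2) \<partial>lebesgue_on \<Omega>) \<le> ennreal (e\<^sup>2)"
        unfolding nn_integral_L2_norm[OF L2_diff[OF L2 L2]]
        by (intro ennreal_leI power_mono N) auto
    qed
    also have "\<dots> = ennreal (e\<^sup>2)"
      by (simp add: Liminf_const)
    finally show ?thesis .
  qed
  have diff_L2: "(\<lambda>z. h n z - g z) \<in> L2_space \<Omega>" if e: "e > 0" and N: "\<And>m. m \<ge> N \<Longrightarrow> L2_norm \<Omega> (\<lambda>z. h n z - h m z) \<le> e" for n N e
    by (rule L2_spaceI_nn_integral) (use fatou[OF e N] in \<open>auto simp: less_top[symmetric] top_unique intro: le_less_trans\<close>)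
  have "g \<in> L2_space \<Omega>"
  proof -
    obtain N where "\<forall>m\<ge>N. \<forall>n\<ge>N. L2_norm \<Omega> (\<lambda>z. h m z - h n z) \<le> 1"
      using cauchy[of 1] by auto
    then have "(\<lambda>z. h N z - g z) \<in> L2_space \<Omega>"
      by (intro diff_L2[of 1 N]) auto
    from L2_diff[OF L2[of N] this] show ?thesis by simp
  qed
  moreover have "g z = 0" if "z \<notin> \<Omega>" for z
  proof -
    have "h n z = 0" for n
      using h that by (auto simp: bergman_space_def)
    then show ?thesis by (simp add: g_def)
  qed
  ultimately have "g \<in> bergman_space \<Omega>"
    using g_hol by (simp add: bergman_space_def)
  moreover have "(\<lambda>n. L2_norm \<Omega> (\<lambda>z. h n z - g z)) \<longlonglongrightarrow> 0"
  proof (rule LIMSEQ_I)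
    fix e :: real assume e: "0 < e"
    then obtain N where N: "\<And>m n. m \<ge> N \<Longrightarrow> n \<ge> N \<Longrightarrow> L2_norm \<Omega> (\<lambda>z. h m z - h n z) \<le> e / 2"
      using cauchy[of "e / 2"] by (metis half_gt_zero)
    have "L2_norm \<Omega> (\<lambda>z. h n z - g z) \<le> e / 2" if "n \<ge> N" for n
    proof (rule L2_norm_leI)
      show "(\<lambda>z. h n z - g z) \<in> L2_space \<Omega>"
        by (rule diff_L2[of "e / 2" N]) (use e N[OF that] in auto)
      show "(\<integral>\<^sup>+z. ennreal ((norm (h n z - g z))\<^sup>2) \<partial>lebesgue_on \<Omega>) \<le> ennreal ((e / 2)\<^sup>2)"
        by (rule fatou[of "e / 2" N]) (use e N[OF that] in auto)
    qed (use e in auto)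
    then show "\<exists>N. \<forall>n\<ge>N. norm (L2_norm \<Omega> (\<lambda>z. h n z - g z) - 0) < e"
      using e by (intro exI[of _ N]) fastforce
  qed
  ultimately show ?thesis by blast
qed

text \<open>The representing function minimizes \<open>\<lambda>h. \<parallel>h\<parallel>\<^sup>2 - 2 Re (l h)\<close>; by the parallelogram law every
  minimizing sequence is Cauchy.\<close>

lemma bergman_Riesz:
  assumes lin: "\<And>f g c. f \<in> bergman_space \<Omega> \<Longrightarrow> g \<in> bergman_space \<Omega> \<Longrightarrow> l (\<lambda>z. f z + c * g z) = l f + c * l g"
    and bdd: "\<And>f. f \<in> bergman_space \<Omega> \<Longrightarrow> cmod (l f) \<le> C * L2_norm \<Omega> f"
  shows "\<exists>h\<in>bergman_space \<Omega>. \<forall>u\<in>bergman_space \<Omega>. l u = L2_inner \<Omega> u h"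
proof -
  let ?H = "bergman_space \<Omega>"
  define \<Phi> where "\<Phi> f = (L2_norm \<Omega> f)\<^sup>2 - 2 * Re (l f)" for f
  \<comment> \<open>Completing the square: x^2 - 2 C x is at least -C^2 for x the norm of
    \<open>f\<close>.\<close>
  have lower: "- C\<^sup>2 \<le> \<Phi> f" if "f \<in> ?H" for f
  proof -
    have "Re (l f) \<le> C * L2_norm \<Omega> f"
      using bdd[OF that] complex_Re_le_cmod[of "l f"] by linarith
    moreover have "0 \<le> (L2_norm \<Omega> f - C)\<^sup>2"
      by simp
    ultimately show ?thesis
      by (simp add: \<Phi>_def power2_eq_square algebra_simps)
  qed
  define I where "I = Inf (\<Phi> ` ?H)"
  have bdd_below: "bdd_below (\<Phi> ` ?H)"
    using lower by (auto intro!: bdd_belowI)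
  have I_le: "I \<le> \<Phi> f" if "f \<in> ?H" for f
    unfolding I_def using that by (intro cInf_lower bdd_below) auto
  have "\<forall>n. \<exists>h. h \<in> ?H \<and> \<Phi> h < I + 1 / real (Suc n)"
  proof
    fix n
    have "Inf (\<Phi> ` ?H) < I + 1 / real (Suc n)"
      by (simp add: I_def)
    then show "\<exists>h. h \<in> ?H \<and> \<Phi> h < I + 1 / real (Suc n)"
      using cInf_lessD[of "\<Phi> ` ?H" "I + 1 / real (Suc n)"] bergman_zero by blast
  qed
  from choice[OF this] obtain h where h: "\<And>n. h n \<in> ?H" and h_less: "\<And>n. \<Phi> (h n) < I + 1 / real (Suc n)"
    by blast
  have L2: "h n \<in> L2_space \<Omega>" for n
    using h by (rule bergman_L2)
  \<comment> \<open>The midpoint of \<open>h m\<close> and \<open>h n\<close> has \<Phi> at least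
    \<open>I\<close>. By the parallelogram law the squared distance is then at most
    \<open>2 * \<Phi> (h m) + 2 * \<Phi> (h n) - 4 * I\<close>, twice the sum of the two excesses
    over \<open>I\<close>.\<close>
  have close: "(L2_norm \<Omega> (\<lambda>z. h m z - h n z))\<^sup>2 \<le> 2 / real (Suc m) + 2 / real (Suc n)" for m n
  proof -
    let ?s = "\<lambda>z. h m z + 1 * h n z" and ?d = "\<lambda>z. h m z + (-1) * h n z"
    have sH: "?s \<in> ?H"
      by (rule bergman_add_cmult[OF h h])
    have "l (\<lambda>z. 0) = 0"
      using lin[OF bergman_zero bergman_zero, of 1] by simp
    then have l_half: "l (\<lambda>z. (1 / 2) * ?s z) = (l (h m) + l (h n)) / 2"
      using lin[OF bergman_zero sH, of "1 / 2"] lin[OF h h, of m 1 n] by simp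
    have "I \<le> \<Phi> (\<lambda>z. (1 / 2) * ?s z)"
      by (intro I_le bergman_cmult sH)
    also have "\<dots> = (L2_norm \<Omega> ?s)\<^sup>2 / 4 - Re (l (h m)) - Re (l (h n))"
      unfolding \<Phi>_def l_half L2_norm_cmult by (simp add: power_divide field_simps)
    finally have "4 * I \<le> (L2_norm \<Omega> ?s)\<^sup>2 - 4 * Re (l (h m)) - 4 * Re (l (h n))"
      by simp
    moreover have "(L2_norm \<Omega> ?s)\<^sup>2 + (L2_norm \<Omega> ?d)\<^sup>2 = 2 * (L2_norm \<Omega> (h m))\<^sup>2 + 2 * (L2_norm \<Omega> (h n))\<^sup>2"
      unfolding L2_norm_add_cmult[OF L2 L2] by simp
    moreover have "\<Phi> (h m) < I + 1 / real (Suc m)" "\<Phi> (h n) < I + 1 / real (Suc n)"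
      by (rule h_less)+
    ultimately have "(L2_norm \<Omega> ?d)\<^sup>2 \<le> 2 * (1 / real (Suc m)) + 2 * (1 / real (Suc n))"
      unfolding \<Phi>_def by linarith
    then show ?thesis by simp
  qed
  have "\<exists>N. \<forall>m\<ge>N. \<forall>n\<ge>N. L2_norm \<Omega> (\<lambda>z. h m z - h n z) \<le> e" if e: "e > 0" for e
  proof -
    obtain N where N: "4 / e\<^sup>2 < real N"
      using reals_Archimedean2 by blast
    have "L2_norm \<Omega> (\<lambda>z. h m z - h n z) \<le> e" if "m \<ge> N" "n \<ge> N" for m n
    proof (rule power2_le_imp_le)
      have small: "2 / real (Suc k) \<le> e\<^sup>2 / 2" if "k \<ge> N" for k
      proof -
        have "4 / e\<^sup>2 < real (Suc k)"
          using N that by linarith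
        then have "4 < real (Suc k) * e\<^sup>2"
          using e by (simp add: pos_divide_less_eq)
        then show ?thesis
          by (simp add: field_simps)
      qed
      show "(L2_norm \<Omega> (\<lambda>z. h m z - h n z))\<^sup>2 \<le> e\<^sup>2"
        using close[of m n] small[OF that(1)] small[OF that(2)] by linarith
    qed (use e in auto)
    then show ?thesis by blast
  qed
  from bergman_complete[OF h this] obtain g where g: "g \<in> ?H"
    and g_lim: "(\<lambda>n. L2_norm \<Omega> (\<lambda>z. h n z - g z)) \<longlonglongrightarrow> 0"
    by blast
  have "l u = L2_inner \<Omega> u g" if u: "u \<in> ?H" for u
  proof -
    have gL2: "g \<in> L2_space \<Omega>" and uL2: "u \<in> L2_space \<Omega>"
      using g u by (auto intro: bergman_L2)
    have inner_lim: "(\<lambda>n. L2_inner \<Omega> (h n) u) \<longlonglongrightarrow> L2_inner \<Omega> g u"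
    proof (rule LIM_zero_cancel, rule Lim_null_comparison)
      show "\<forall>\<^sub>F n in sequentially. norm (L2_inner \<Omega> (h n) u - L2_inner \<Omega> g u) \<le> L2_norm \<Omega> (\<lambda>z. h n z - g z) * L2_norm \<Omega> u"
        unfolding L2_inner_diff_left[OF L2 gL2 uL2, symmetric]
        by (intro always_eventually allI L2_Cauchy_Schwarz L2_diff L2 gL2 uL2)
      show "(\<lambda>n. L2_norm \<Omega> (\<lambda>z. h n z - g z) * L2_norm \<Omega> u) \<longlonglongrightarrow> 0"
        using tendsto_mult_left_zero[OF g_lim] .
    qed
    define w where "w = L2_inner \<Omega> g u - cnj (l u)"
    \<comment> \<open>The competitor \<open>h n + t * u\<close> cannot lie below the infimum;
      passing to the limit in \<open>n\<close> gives a quadratic inequality in \<open>t\<close>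
      whose linear term must vanish.\<close>
    have ineq: "0 \<le> 2 * Re (cnj t * w) + (cmod t)\<^sup>2 * (L2_norm \<Omega> u)\<^sup>2" for t
    proof (rule tendsto_le[OF sequentially_bot])
      show "(\<lambda>n. 2 * Re (cnj t * (L2_inner \<Omega> (h n) u - cnj (l u))) + (cmod t)\<^sup>2 * (L2_norm \<Omega> u)\<^sup>2)
          \<longlonglongrightarrow> 2 * Re (cnj t * w) + (cmod t)\<^sup>2 * (L2_norm \<Omega> u)\<^sup>2"
        unfolding w_def by (intro tendsto_intros inner_lim)
      show "(\<lambda>n. - (1 / real (Suc n))) \<longlonglongrightarrow> 0"
        using tendsto_minus[OF LIMSEQ_Suc[OF lim_1_over_n]] by simp
      have "- (1 / real (Suc n)) \<le> 2 * Re (cnj t * (L2_inner \<Omega> (h n) u - cnj (l u))) + (cmod t)\<^sup>2 * (L2_norm \<Omega> u)\<^sup>2" for n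
      proof -
        have "I \<le> \<Phi> (\<lambda>z. h n z + t * u z)"
          by (intro I_le bergman_add_cmult h u)
        also have "\<dots> = \<Phi> (h n) + (2 * Re (cnj t * (L2_inner \<Omega> (h n) u - cnj (l u))) + (cmod t)\<^sup>2 * (L2_norm \<Omega> u)\<^sup>2)"
          unfolding \<Phi>_def L2_norm_add_cmult[OF L2 uL2] lin[OF h u] by (simp add: algebra_simps)
        finally show ?thesis
          using h_less[of n] by linarith
      qed
      then show "\<forall>\<^sub>F n in sequentially. - (1 / real (Suc n)) \<le> 2 * Re (cnj t * (L2_inner \<Omega> (h n) u - cnj (l u))) + (cmod t)\<^sup>2 * (L2_norm \<Omega> u)\<^sup>2"
        by simp
    qed
    have "w = 0"
    proof (rule ccontr)
      assume "w \<noteq> 0"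
      define M where "M = (L2_norm \<Omega> u)\<^sup>2"
      \<comment> \<open>The test value is t = -s w, for which the quadratic expression becomes s
        |w|^2 (s M - 2). The choice ensures s M < 1, and the summand 1 allows M = 0.\<close>
      define s where "s = 1 / (M + 1)"
      have M: "0 \<le> M" and s: "0 < s" "s * M < 1"
        by (auto simp: M_def s_def add_nonneg_pos)
      have "0 \<le> 2 * Re (cnj (of_real (- s) * w) * w) + (cmod (of_real (- s) * w))\<^sup>2 * M"
        unfolding M_def by (rule ineq)
      also have "cnj (of_real (- s) * w) * w = of_real (- s * (cmod w)\<^sup>2)"
        using complex_norm_square[of w] by (simp add: mult.commute)
      also have "2 * Re (of_real (- s * (cmod w)\<^sup>2)) + (cmod (of_real (- s) * w))\<^sup>2 * M = s * (cmod w)\<^sup>2 * (s * M - 2)"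
        using s by (simp add: norm_mult power2_eq_square algebra_simps)
      finally have "0 \<le> s * (cmod w)\<^sup>2 * (s * M - 2)" .
      moreover have "0 < s * (cmod w)\<^sup>2"
        using s \<open>w \<noteq> 0\<close> by simp
      ultimately show False
        using s by (simp add: zero_le_mult_iff)
    qed
    then have "L2_inner \<Omega> g u = cnj (l u)"
      by (simp add: w_def)
    then show ?thesis
      by (simp add: L2_inner_commute[of \<Omega> u g])
  qed
  with g show ?thesis by blast
qed

section \<open>The projection and the reproducing kernel\<close>

lemma bergman_representative_unique:
  assumes "h \<in> bergman_space \<Omega>" "k \<in> bergman_space \<Omega>"
    and "\<And>u. u \<in> bergman_space \<Omega> \<Longrightarrow> L2_inner \<Omega> u h = L2_inner \<Omega> u k"
  shows "h = k"
proof (rule bergman_eq_if_norm_diff_0[OF assms(1,2)])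
  \<comment> \<open>The difference is itself a member of the space, so it may be used as the test
    function.\<close>
  have d: "(\<lambda>z. h z - k z) \<in> bergman_space \<Omega>"
    by (rule bergman_diff[OF assms(1,2)])
  note L2 = bergman_L2[OF assms(1)] bergman_L2[OF assms(2)] bergman_L2[OF d]
  have "L2_inner \<Omega> (\<lambda>z. h z - k z) (\<lambda>z. h z - k z) = cnj (L2_inner \<Omega> (\<lambda>z. h z - k z) h) - cnj (L2_inner \<Omega> (\<lambda>z. h z - k z) k)"
    unfolding L2_inner_diff_left[OF L2] by (simp only: L2_inner_commute[of \<Omega> _ "\<lambda>z. h z - k z"])
  then show "L2_norm \<Omega> (\<lambda>z. h z - k z) = 0"
    using assms(3)[OF d] by (simp add: L2_inner_self)
qed

lemma bergman_projection:
  assumes g: "g \<in> L2_space \<Omega>"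
  shows "bergman_projection \<Omega> g \<in> bergman_space \<Omega>"
    and "u \<in> bergman_space \<Omega> \<Longrightarrow> L2_inner \<Omega> (\<lambda>z. g z - bergman_projection \<Omega> g z) u = 0"
proof -
  let ?P = "\<lambda>h. h \<in> bergman_space \<Omega> \<and> (\<forall>u\<in>bergman_space \<Omega>. L2_inner \<Omega> (\<lambda>z. g z - h z) u = 0)"
  \<comment> \<open>Orthogonality of the remainder is rewritten as representation of the functional
    u -> <u, g>, the form that \<open>bergman_Riesz\<close> delivers.\<close>
  have iff: "L2_inner \<Omega> (\<lambda>z. g z - h z) u = 0 \<longleftrightarrow> L2_inner \<Omega> u g = L2_inner \<Omega> u h"
    if "h \<in> bergman_space \<Omega>" "u \<in> bergman_space \<Omega>" for h u
    unfolding L2_inner_diff_left[OF g bergman_L2[OF that(1)] bergman_L2[OF that(2)]]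
    by (simp add: L2_inner_commute[of \<Omega> g u] L2_inner_commute[of \<Omega> h u])
  have "\<exists>h\<in>bergman_space \<Omega>. \<forall>u\<in>bergman_space \<Omega>. L2_inner \<Omega> u g = L2_inner \<Omega> u h"
  proof (rule bergman_Riesz)
    show "cmod (L2_inner \<Omega> f g) \<le> L2_norm \<Omega> g * L2_norm \<Omega> f" if "f \<in> bergman_space \<Omega>" for f
      using L2_Cauchy_Schwarz[OF bergman_L2[OF that] g] by (simp add: mult.commute)
  qed (intro L2_inner_add_cmult_left bergman_L2 g)
  then obtain h where h: "?P h"
    using iff by blast
  have "?P (THE h. ?P h)"
  proof (rule theI[of ?P, OF h])
    show "k = h" if "?P k" for k
      by (rule bergman_representative_unique) (use that h iff in auto)
  qed
  then show "bergman_projection \<Omega> g \<in> bergman_space \<Omega>"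
    and "u \<in> bergman_space \<Omega> \<Longrightarrow> L2_inner \<Omega> (\<lambda>z. g z - bergman_projection \<Omega> g z) u = 0"
    unfolding bergman_projection_def by auto
qed

text \<open>Pythagoras for \<open>g\<close> as the sum of its projection and a remainder orthogonal
  to it.\<close>

lemma bergman_projection_norm_le:
  assumes g: "g \<in> L2_space \<Omega>"
  shows "L2_norm \<Omega> (bergman_projection \<Omega> g) \<le> L2_norm \<Omega> g"
proof (rule power2_le_imp_le)
  let ?h = "bergman_projection \<Omega> g"
  have h: "?h \<in> bergman_space \<Omega>"
    by (rule bergman_projection[OF g])
  have d: "(\<lambda>z. g z - ?h z) \<in> L2_space \<Omega>"
    by (rule L2_diff[OF g bergman_L2[OF h]])
  have "(L2_norm \<Omega> (\<lambda>z. (g z - ?h z) + 1 * ?h z))\<^sup>2 = (L2_norm \<Omega> (\<lambda>z. g z - ?h z))\<^sup>2 + (L2_norm \<Omega> ?h)\<^sup>2"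
    unfolding L2_norm_add_cmult[OF d bergman_L2[OF h]] bergman_projection(2)[OF g h] by simp
  then show "(L2_norm \<Omega> ?h)\<^sup>2 \<le> (L2_norm \<Omega> g)\<^sup>2"
    by simp
qed simp

lemma bergman_kernel_reproducing:
  assumes w: "w \<in> \<Omega>"
  shows "(\<lambda>z. bergman_kernel \<Omega> z w) \<in> bergman_space \<Omega>"
    and "f \<in> bergman_space \<Omega> \<Longrightarrow> f w = L2_inner \<Omega> f (\<lambda>z. bergman_kernel \<Omega> z w)"
proof -
  let ?P = "\<lambda>h. h \<in> bergman_space \<Omega> \<and> (\<forall>f\<in>bergman_space \<Omega>. f w = L2_inner \<Omega> f h)"
  obtain C where C: "\<And>f. f \<in> bergman_space \<Omega> \<Longrightarrow> norm (f w) \<le> C * L2_norm \<Omega> f"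
    using bergman_eval_bound[OF w] by metis
  have "\<exists>h\<in>bergman_space \<Omega>. \<forall>f\<in>bergman_space \<Omega>. f w = L2_inner \<Omega> f h"
    by (rule bergman_Riesz[where l = "\<lambda>f. f w"]) (auto intro: C)
  then obtain h where h: "?P h"
    by blast
  have "?P (THE h. ?P h)"
  proof (rule theI[of ?P, OF h])
    show "k = h" if "?P k" for k
      by (rule bergman_representative_unique) (use that h in auto)
  qed
  then show "(\<lambda>z. bergman_kernel \<Omega> z w) \<in> bergman_space \<Omega>"
    and "f \<in> bergman_space \<Omega> \<Longrightarrow> f w = L2_inner \<Omega> f (\<lambda>z. bergman_kernel \<Omega> z w)"
    unfolding bergman_kernel_def by auto
qed

text \<open>By reproduction, both values are inner products of the same two kernel functions, in
  opposite orders.\<close>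

lemma bergman_kernel_commute:
  assumes "z \<in> \<Omega>" "w \<in> \<Omega>"
  shows "bergman_kernel \<Omega> z w = cnj (bergman_kernel \<Omega> w z)"
  using bergman_kernel_reproducing(2)[OF assms(1) bergman_kernel_reproducing(1)[OF assms(2)]]
    bergman_kernel_reproducing(2)[OF assms(2) bergman_kernel_reproducing(1)[OF assms(1)]]
  by (metis L2_inner_commute)

lemma bergman_kernel_diagonal:
  assumes "z \<in> \<Omega>"
  shows "bergman_kernel \<Omega> z z = of_real ((L2_norm \<Omega> (\<lambda>w. bergman_kernel \<Omega> w z))\<^sup>2)"
  using bergman_kernel_reproducing(2)[OF assms bergman_kernel_reproducing(1)[OF assms]] by (simp add: L2_inner_self)

text \<open>As a function of \<open>w\<close>, the normalized kernel is antiholomorphic under the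
  convention for \<open>bergman_kernel\<close>. Its modulus is that of its conjugate, a multiple of
  the kernel function of \<open>z\<close>, which does lie in the Bergman space.\<close>

lemma norm_normalized_bergman_kernel:
  assumes "z \<in> \<Omega>" "w \<in> \<Omega>"
  shows "norm (normalized_bergman_kernel \<Omega> z w) =
    norm (bergman_kernel \<Omega> w z) / L2_norm \<Omega> (\<lambda>w. bergman_kernel \<Omega> w z)"
  unfolding normalized_bergman_kernel_def norm_divide bergman_kernel_commute[OF assms]
    bergman_kernel_diagonal[OF assms(1)]
  by (simp del: of_real_power)

end

section \<open>Composition with a self-map\<close>

text \<open>The analytic core, free of boundary values: on \<open>V\<close> change of variables
  applies, off \<open>V\<close> the composite is bounded by the supremum of |f| over
  \<open>L\<close>.\<close>

lemma bergman_composition_bounded: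
  fixes \<Omega> V L :: "(complex ^ 'n) set" and \<phi> :: "complex ^ 'n \<Rightarrow> complex ^ 'n"
  assumes \<Omega>: "open \<Omega>" "bounded \<Omega>"
    and \<phi>: "\<phi> ` \<Omega> \<subseteq> \<Omega>" "\<And>z. z \<in> \<Omega> \<Longrightarrow> \<phi> differentiable (at z)"
    and V: "open V" "V \<subseteq> \<Omega>" "inj_on \<phi> V"
    and c: "0 < c" "\<And>z. z \<in> V \<Longrightarrow> c \<le> \<bar>real_jacobian \<phi> z\<bar>"
    and L: "compact L" "L \<subseteq> \<Omega>" "\<phi> ` (\<Omega> - V) \<subseteq> L"
  shows "\<exists>C>0. \<forall>f\<in>bergman_space \<Omega>. f \<circ> \<phi> \<in> L2_space \<Omega> \<and> L2_norm \<Omega> (f \<circ> \<phi>) \<le> C * L2_norm \<Omega> f"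
proof -
  obtain A where A: "0 < A" "\<And>f z. f \<in> bergman_space \<Omega> \<Longrightarrow> z \<in> L \<Longrightarrow> norm (f z) \<le> A * L2_norm \<Omega> f"
    using bergman_compact_bound[OF \<Omega>(1) L(1,2)] by metis
  obtain \<sigma> :: "'n bit0 \<Rightarrow> 'n + 'n" where \<sigma>: "bij \<sigma>"
    using ex_bij_bit0_sum by blast
  have b: "bij_betw (real_dir \<circ> \<sigma>) UNIV (Basis :: (complex ^ 'n) set)"
    using bij_betw_trans[OF \<sigma> real_dir_bij] .
  have \<phi>_cont: "continuous_on \<Omega> \<phi>"
    using \<phi>(2) by (meson continuous_at_imp_continuous_on differentiable_imp_continuous_within)
  have [measurable]: "\<Omega> \<in> sets borel" "V \<in> sets borel"
    using \<Omega> V by auto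
  \<comment> \<open>The summand \<open>1 / c\<close> pays for \<open>V\<close>; the other is the
    squared evaluation constant on \<open>L\<close> times the volume of \<Omega>.\<close>
  define D where "D = 1 / c + measure lborel \<Omega> * A\<^sup>2"
  have D: "0 < D"
    using c by (auto simp: D_def intro!: add_pos_nonneg)
  have fin: "emeasure lborel \<Omega> = ennreal (measure lborel \<Omega>)"
    using emeasure_bounded_finite[OF \<Omega>(2)] by (simp add: emeasure_eq_ennreal_measure less_top[symmetric])
  have key: "f \<circ> \<phi> \<in> borel_measurable (lebesgue_on \<Omega>) \<and>
      (\<integral>\<^sup>+z. ennreal ((norm ((f \<circ> \<phi>) z))\<^sup>2) \<partial>lebesgue_on \<Omega>) \<le> ennreal ((sqrt D * L2_norm \<Omega> f)\<^sup>2)"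
    if f: "f \<in> bergman_space \<Omega>" for f
  proof
    let ?G = "\<lambda>z. ennreal ((norm (f (\<phi> z)))\<^sup>2)"
    have cont: "continuous_on \<Omega> (f \<circ> \<phi>)"
    proof (rule continuous_on_compose[OF \<phi>_cont], rule continuous_on_subset[OF _ \<phi>(1)])
      show "continuous_on \<Omega> f"
        using f holomorphic_Cn_continuous_on by (auto simp: bergman_space_def)
    qed
    show "f \<circ> \<phi> \<in> borel_measurable (lebesgue_on \<Omega>)"
      using cont \<Omega> by (intro continuous_imp_measurable_on_sets_lebesgue) auto
    have meas: "(\<lambda>z. indicator S z * ?G z) \<in> borel_measurable borel" if S: "open S" "S \<subseteq> \<Omega>" for S
    proof -
      have [measurable]: "(\<lambda>z. indicator S z *\<^sub>R (f \<circ> \<phi>) z) \<in> borel_measurable borel"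
        using S by (intro borel_measurable_continuous_on_indicator continuous_on_subset[OF cont]) auto
      have "(\<lambda>z. indicator S z * ?G z) = (\<lambda>z. ennreal ((norm (indicator S z *\<^sub>R (f \<circ> \<phi>) z))\<^sup>2))"
        by (auto simp: indicator_def)
      then show ?thesis by (simp only:) measurable
    qed
    have near: "(\<integral>\<^sup>+z. indicator V z * ?G z \<partial>lborel) \<le> ennreal (1 / c * (L2_norm \<Omega> f)\<^sup>2)"
    proof -
      have "ennreal c * (\<integral>\<^sup>+z. indicator V z * ?G z \<partial>lborel) \<le> (\<integral>\<^sup>+z. ennreal ((norm (f z))\<^sup>2) \<partial>lborel)"
      proof (rule nn_integral_injective_image_le[OF b V(1) _ V(3) _ c(1) bergman_integrable_lborel[OF \<Omega>(1) f]])
        show "(\<phi> has_derivative frechet_derivative \<phi> (at z)) (at z)" if "z \<in> V" for z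
          using \<phi>(2) that V(2) by (auto simp: frechet_derivative_works[symmetric])
        show "c \<le> \<bar>det (\<chi> i j. frechet_derivative \<phi> (at z) ((real_dir \<circ> \<sigma>) j) \<bullet> (real_dir \<circ> \<sigma>) i)\<bar>" if "z \<in> V" for z
          using c(2)[OF that] real_frame_det[OF \<sigma>, of "frechet_derivative \<phi> (at z)"]
          by (simp add: real_jacobian_def partial_deriv_def)
      qed simp
      also have "\<dots> = ennreal ((L2_norm \<Omega> f)\<^sup>2)"
        by (rule nn_integral_bergman[OF \<Omega>(1) f])
      finally have "ennreal (1 / c) * (ennreal c * (\<integral>\<^sup>+z. indicator V z * ?G z \<partial>lborel)) \<le> ennreal (1 / c) * ennreal ((L2_norm \<Omega> f)\<^sup>2)"
        by (rule mult_left_mono) simp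
      then show ?thesis
        using c(1) by (simp add: mult.assoc[symmetric] ennreal_mult[symmetric])
    qed
    have far: "indicator \<Omega> z * ?G z \<le> indicator V z * ?G z + ennreal ((A * L2_norm \<Omega> f)\<^sup>2) * indicator \<Omega> z" for z
    proof (cases "z \<in> \<Omega> - V")
      case True
      then have "norm (f (\<phi> z)) \<le> A * L2_norm \<Omega> f"
        using A(2)[OF f] L(3) by blast
      then have "?G z \<le> ennreal ((A * L2_norm \<Omega> f)\<^sup>2)"
        by (intro ennreal_leI power_mono) auto
      with True show ?thesis
        by simp
    qed (use V(2) in \<open>auto simp: indicator_def\<close>)
    have "(\<integral>\<^sup>+z. ennreal ((norm ((f \<circ> \<phi>) z))\<^sup>2) \<partial>lebesgue_on \<Omega>) = (\<integral>\<^sup>+z. indicator \<Omega> z * ?G z \<partial>lborel)"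
      using nn_integral_lebesgue_on[OF \<Omega>(1) meas[OF \<Omega>(1)]] by simp
    also have "\<dots> \<le> (\<integral>\<^sup>+z. (indicator V z * ?G z + ennreal ((A * L2_norm \<Omega> f)\<^sup>2) * indicator \<Omega> z) \<partial>lborel)"
      by (intro nn_integral_mono far)
    also have "\<dots> = (\<integral>\<^sup>+z. indicator V z * ?G z \<partial>lborel) + ennreal ((A * L2_norm \<Omega> f)\<^sup>2) * emeasure lborel \<Omega>"
      using meas[OF V(1,2)] by (subst nn_integral_add) (auto simp: nn_integral_cmult_indicator)
    also have "\<dots> \<le> ennreal (1 / c * (L2_norm \<Omega> f)\<^sup>2) + ennreal ((A * L2_norm \<Omega> f)\<^sup>2) * ennreal (measure lborel \<Omega>)"
      unfolding fin by (intro add_right_mono near)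
    also have "\<dots> = ennreal (1 / c * (L2_norm \<Omega> f)\<^sup>2 + (A * L2_norm \<Omega> f)\<^sup>2 * measure lborel \<Omega>)"
      using c(1) by (simp add: ennreal_mult[symmetric] ennreal_plus[symmetric] del: ennreal_plus)
    also have "1 / c * (L2_norm \<Omega> f)\<^sup>2 + (A * L2_norm \<Omega> f)\<^sup>2 * measure lborel \<Omega> = (sqrt D * L2_norm \<Omega> f)\<^sup>2"
      using D by (simp add: power_mult_distrib D_def algebra_simps)
    finally show "(\<integral>\<^sup>+z. ennreal ((norm ((f \<circ> \<phi>) z))\<^sup>2) \<partial>lebesgue_on \<Omega>) \<le> ennreal ((sqrt D * L2_norm \<Omega> f)\<^sup>2)" .
  qed
  have L2: "f \<circ> \<phi> \<in> L2_space \<Omega>" if "f \<in> bergman_space \<Omega>" for f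
    by (rule L2_spaceI_nn_integral) (use key[OF that] in \<open>auto intro: le_less_trans\<close>)
  have "L2_norm \<Omega> (f \<circ> \<phi>) \<le> sqrt D * L2_norm \<Omega> f" if "f \<in> bergman_space \<Omega>" for f
    using key[OF that] D by (intro L2_norm_leI L2[OF that]) auto
  with L2 D show ?thesis
    by (intro exI[of _ "sqrt D"]) simp
qed

text \<open>A point of the closure outside \<open>S\<close> is a limit point of \<open>S\<close>, so
  the limit defining \<open>cont_ext\<close> is unique. Any explicit continuous extension can
  therefore replace \<open>cont_ext\<close>.\<close>

lemma cont_ext_eq:
  fixes f g :: "'a::metric_space \<Rightarrow> 'b::t2_space"
  assumes g: "continuous_on (closure S) g" "\<And>x. x \<in> S \<Longrightarrow> g x = f x" and z: "z \<in> closure S"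
  shows "cont_ext S f z = g z"
proof (cases "z \<in> S")
  case True
  then show ?thesis
    using g(2) by (simp add: cont_ext_def)
next
  case False
  have "z islimpt S"
    using z False by (simp add: closure_def)
  then have "at z within S \<noteq> bot"
    by (simp add: trivial_limit_within)
  moreover have "(f \<longlongrightarrow> g z) (at z within S)"
  proof -
    have "(g \<longlongrightarrow> g z) (at z within closure S)"
      using g(1) z by (simp add: continuous_on_def)
    then have "(g \<longlongrightarrow> g z) (at z within S)"
      using closure_subset by (rule tendsto_within_subset)
    then show ?thesis
      by (rule Lim_transform_eventually) (auto simp: eventually_at_filter g(2))
  qed
  ultimately show ?thesis
    using False by (simp add: cont_ext_def tendsto_Lim)
qed

theorem corollary1:
  fixes \<Omega> :: "(complex ^ 'n) set"
    and \<phi> :: "complex ^ 'n \<Rightarrow> complex ^ 'n"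
    and K F U :: "(complex ^ 'n) set"
  assumes "domain_Cn \<Omega>" and "smooth_bounded \<Omega>" and "strongly_pseudoconvex \<Omega>"
    and "\<phi> ` \<Omega> \<subseteq> \<Omega>" and "Ck_closure 2 \<Omega> \<phi>"
    and "K = cont_ext \<Omega> \<phi> ` frontier \<Omega> \<inter> frontier \<Omega>"
    and "F = {z \<in> closure \<Omega>. cont_ext \<Omega> \<phi> z \<in> K}"
    and "open U" and "F \<subseteq> U" and "inj_on \<phi> (U \<inter> \<Omega>)"
    and "\<forall>i j. \<forall>z\<in>F. cont_ext \<Omega> (wirtinger_bar j (\<lambda>w. \<phi> w $ i)) z = 0"
    and "\<exists>m>0. \<forall>z\<in>F. \<bar>cont_ext \<Omega> (real_jacobian \<phi>) z\<bar> \<ge> m"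
  shows "K_op_bounded \<Omega> \<phi> \<longleftrightarrow>
    (SUP z\<in>\<Omega>. \<integral>\<^sup>+w. ennreal ((norm (normalized_bergman_kernel \<Omega> z (\<phi> w)))\<^sup>2) \<partial>lebesgue_on \<Omega>) < \<infinity>"
proof -
  have \<Omega>: "open \<Omega>" "bounded \<Omega>"
    using assms(1,2) by (auto simp: domain_Cn_def smooth_bounded_def)
  have Ck: "Ck_on 2 \<Omega> \<phi>"
    and ext: "\<And>vs. set vs \<subseteq> Basis \<Longrightarrow> length vs \<le> 2 \<Longrightarrow>
      \<exists>g. continuous_on (closure \<Omega>) g \<and> (\<forall>x\<in>\<Omega>. g x = iter_partial vs \<phi> x)"
    using assms(5) by (auto simp: Ck_closure_def)
  have diff: "\<phi> differentiable (at z)" if "z \<in> \<Omega>" for z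
  proof -
    have "\<phi> differentiable_on \<Omega>"
      using Ck[unfolded Ck_on_def, rule_format, of "[]"] by simp
    then show ?thesis
      using \<Omega>(1) that by (simp add: differentiable_on_eq_differentiable_at)
  qed
  obtain g where g: "continuous_on (closure \<Omega>) g" "\<And>x. x \<in> \<Omega> \<Longrightarrow> g x = \<phi> x"
    using ext[of "[]"] by auto
  have "\<exists>d. continuous_on (closure \<Omega>) d \<and> (\<forall>x\<in>\<Omega>. d x = partial_deriv (real_dir a) \<phi> x)" for a
    using ext[of "[real_dir a]"] real_dir_bij by (auto simp: bij_betw_def)
  then obtain d where d: "\<And>a. continuous_on (closure \<Omega>) (d a)"
    "\<And>a x. x \<in> \<Omega> \<Longrightarrow> d a x = partial_deriv (real_dir a) \<phi> x"
    by metis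
  \<comment> \<open>The determinant is a polynomial in the first partial derivatives, so their
    continuous extensions \<open>d\<close> extend the Jacobian to the closure.\<close>
  define J where "J z = \<bar>det (\<chi> a b. d b z \<bullet> real_dir a :: real ^ ('n + 'n) ^ ('n + 'n))\<bar>" for z
  have J_cont: "continuous_on (closure \<Omega>) J"
    unfolding J_def det_def by (simp, intro continuous_intros d)
  have J_eq: "J z = \<bar>real_jacobian \<phi> z\<bar>" if "z \<in> \<Omega>" for z
    using that by (simp add: J_def real_jacobian_def d(2))
  have J_ext: "\<bar>cont_ext \<Omega> (real_jacobian \<phi>) z\<bar> = J z" if "z \<in> closure \<Omega>" for z
  proof -
    have "cont_ext \<Omega> (real_jacobian \<phi>) z = det (\<chi> a b. d b z \<bullet> real_dir a :: real ^ ('n + 'n) ^ ('n + 'n))"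
    proof (rule cont_ext_eq[OF _ _ that])
      show "continuous_on (closure \<Omega>) (\<lambda>z. det (\<chi> a b. d b z \<bullet> real_dir a :: real ^ ('n + 'n) ^ ('n + 'n)))"
        unfolding det_def by (simp, intro continuous_intros d)
    qed (simp add: real_jacobian_def d(2))
    then show ?thesis by (simp add: J_def)
  qed
  have \<phi>_ext: "cont_ext \<Omega> \<phi> z = g z" if "z \<in> closure \<Omega>" for z
    using g(1) g(2) that by (rule cont_ext_eq)
  obtain m where m: "0 < m" "\<And>z. z \<in> F \<Longrightarrow> m \<le> J z"
    using assms(7,12) J_ext by auto
  \<comment> \<open>Any threshold strictly between 0 and \<open>m\<close> would do: \<open>F\<close>
    has \<open>J\<close> at least \<open>m\<close>, so it stays out of the closed condition that
    defines \<open>A\<close>, while \<open>J\<close> is bounded below on \<open>V\<close>.\<close>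
  define V where "V = (\<Omega> \<inter> J -` {m / 2<..}) \<inter> U"
  define A where "A = (closure \<Omega> \<inter> J -` {..m / 2}) \<union> (closure \<Omega> - U)"
  have V: "open V" "V \<subseteq> \<Omega>" "inj_on \<phi> V"
  proof -
    show "open V"
      unfolding V_def using \<Omega>(1) assms(8) continuous_on_subset[OF J_cont closure_subset]
      by (intro open_Int continuous_open_preimage) auto
    show "inj_on \<phi> V"
      using assms(10) by (rule inj_on_subset) (auto simp: V_def)
  qed (auto simp: V_def)
  have "compact (closure \<Omega>)"
    using \<Omega>(2) by simp
  then have "compact A"
    unfolding A_def using assms(8) continuous_closed_preimage[OF J_cont closed_closure, of "{..m / 2}"]
    by (auto simp: compact_eq_bounded_closed Diff_eq intro: bounded_subset)
  moreover have A_sub: "A \<subseteq> closure \<Omega>"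
    by (auto simp: A_def)
  ultimately have gA_compact: "compact (g ` A)"
    using g(1) by (intro compact_continuous_image continuous_on_subset[OF g(1)])
  \<comment> \<open>If \<open>g z\<close> were on the boundary, \<open>z\<close> would be too, since
    \<phi> maps \<Omega> into itself. Then \<open>z\<close> would lie in \<open>F\<close>, hence in
    \<open>U\<close> with \<open>J z\<close> at least \<open>m\<close>, so outside
    \<open>A\<close>.\<close>
  have gA_sub: "g ` A \<subseteq> \<Omega>"
  proof
    fix y assume "y \<in> g ` A"
    then obtain z where z: "z \<in> A" "y = g z"
      by blast
    have zc: "z \<in> closure \<Omega>"
      using z A_sub by blast
    have "g ` closure \<Omega> \<subseteq> closure \<Omega>"
      by (rule image_closure_subset[OF g(1) closed_closure]) (use g(2) assms(4) closure_subset in fastforce)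
    then have yc: "y \<in> closure \<Omega>"
      using z zc by blast
    show "y \<in> \<Omega>"
    proof (rule ccontr)
      assume y: "y \<notin> \<Omega>"
      then have "z \<notin> \<Omega>"
        using z g(2) assms(4) by auto
      then have "z \<in> frontier \<Omega>" "y \<in> frontier \<Omega>"
        using zc yc y \<Omega>(1) by (auto simp: frontier_def interior_open)
      then have "z \<in> F"
        using zc z(2) by (auto simp: assms(6,7) \<phi>_ext[OF zc] intro: image_eqI[where x = z])
      then show False
        using z(1) m(1) m(2)[of z] assms(9) by (auto simp: A_def)
    qed
  qed
  have far: "\<phi> ` (\<Omega> - V) \<subseteq> g ` A"
  proof
    fix y assume "y \<in> \<phi> ` (\<Omega> - V)"
    then obtain z where z: "z \<in> \<Omega>" "z \<notin> V" "y = \<phi> z"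
      by blast
    then have "z \<in> A"
      using closure_subset[of \<Omega>] by (auto simp: A_def V_def)
    then show "y \<in> g ` A"
      using z(3) g(2)[OF z(1)] by (metis image_eqI)
  qed
  have near: "m / 2 \<le> \<bar>real_jacobian \<phi> z\<bar>" if "z \<in> V" for z
    using that J_eq[of z] by (auto simp: V_def)
  have "0 < m / 2"
    using m(1) by simp
  obtain C where C: "0 < C"
    "\<And>f. f \<in> bergman_space \<Omega> \<Longrightarrow> f \<circ> \<phi> \<in> L2_space \<Omega>"
    "\<And>f. f \<in> bergman_space \<Omega> \<Longrightarrow> L2_norm \<Omega> (f \<circ> \<phi>) \<le> C * L2_norm \<Omega> f"
    using bergman_composition_bounded[OF \<Omega> assms(4) diff V \<open>0 < m / 2\<close> near gA_compact gA_sub far] by auto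
  have "K_op_bounded \<Omega> \<phi>"
    unfolding K_op_bounded_def K_op_def
    using C bergman_projection_norm_le[OF \<Omega>(1) C(2)] by (meson order_trans)
  moreover have "(SUP z\<in>\<Omega>. \<integral>\<^sup>+w. ennreal ((norm (normalized_bergman_kernel \<Omega> z (\<phi> w)))\<^sup>2) \<partial>lebesgue_on \<Omega>) \<le> ennreal (C\<^sup>2)"
  proof (rule SUP_least)
    fix z assume z: "z \<in> \<Omega>"
    define k where "k w = bergman_kernel \<Omega> w z" for w
    have k: "k \<in> bergman_space \<Omega>"
      unfolding k_def by (rule bergman_kernel_reproducing[OF \<Omega>(1) z])
    \<comment> \<open>In modulus this is the normalized kernel. If \<open>k\<close> has norm 0, then
      \<open>inverse 0 = 0\<close> makes \<open>f\<close> vanish, as does the normalized kernel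
      through division by 0; so the norm of \<open>f\<close> is at most 1 in every case.\<close>
    define f where "f w = of_real (inverse (L2_norm \<Omega> k)) * k w" for w
    have f: "f \<in> bergman_space \<Omega>"
      unfolding f_def by (rule bergman_cmult[OF k])
    have "L2_norm \<Omega> f \<le> 1"
      unfolding f_def L2_norm_cmult by (cases "L2_norm \<Omega> k = 0") (simp_all add: norm_inverse)
    then have "L2_norm \<Omega> (f \<circ> \<phi>) \<le> C"
      using C(3)[OF f] C(1) by (meson mult_left_le order_less_imp_le order_trans)
    have "(\<integral>\<^sup>+w. ennreal ((norm (normalized_bergman_kernel \<Omega> z (\<phi> w)))\<^sup>2) \<partial>lebesgue_on \<Omega>) =
        (\<integral>\<^sup>+w. ennreal ((norm ((f \<circ> \<phi>) w))\<^sup>2) \<partial>lebesgue_on \<Omega>)"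
    proof (rule nn_integral_cong)
      fix w assume "w \<in> space (lebesgue_on \<Omega>)"
      then have "\<phi> w \<in> \<Omega>"
        using assms(4) by auto
      from norm_normalized_bergman_kernel[OF \<Omega>(1) z this]
      show "ennreal ((norm (normalized_bergman_kernel \<Omega> z (\<phi> w)))\<^sup>2) = ennreal ((norm ((f \<circ> \<phi>) w))\<^sup>2)"
        by (simp add: f_def k_def[abs_def] norm_mult norm_inverse divide_inverse mult.commute)
    qed
    also have "\<dots> = ennreal ((L2_norm \<Omega> (f \<circ> \<phi>))\<^sup>2)"
      by (rule nn_integral_L2_norm[OF C(2)[OF f]])
    also have "\<dots> \<le> ennreal (C\<^sup>2)"
      using \<open>L2_norm \<Omega> (f \<circ> \<phi>) \<le> C\<close> by (intro ennreal_leI power_mono) auto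
    finally show "(\<integral>\<^sup>+w. ennreal ((norm (normalized_bergman_kernel \<Omega> z (\<phi> w)))\<^sup>2) \<partial>lebesgue_on \<Omega>) \<le> ennreal (C\<^sup>2)" .
  qed
  then have "(SUP z\<in>\<Omega>. \<integral>\<^sup>+w. ennreal ((norm (normalized_bergman_kernel \<Omega> z (\<phi> w)))\<^sup>2) \<partial>lebesgue_on \<Omega>) < \<infinity>"
    by (rule le_less_trans) simp
  ultimately show ?thesis by simp
qed

end
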